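(* Let $T\in\mathbb{N}$, $L\in[0,\infty)$, let $(\mathcal{Z},\mathscr{G})$ and $(\mathcal{B},\mathscr{H})$ be measurable spaces, let $\ell:\mathcal{B}\times\mathcal{Z}\to[0,L]$ be measurable, and let $P$ and $Q$ be probability measures on $(\mathcal{Z}^T,\mathscr{G}^{\otimes T})$ admitting Markov kernels $K_P^{(t)}$ and $K_Q^{(t)}$ ($t=1,\dots,T$) as described in the context. Let $(Z_1,\dots,Z_T)\sim P$, let $(b_t^* )_{t=1}^T$ be a measurable $P$-optimal policy, let $(b_t)_{t=1}^T$ be a measurable $Q$-optimal policy, and let $\Delta$ be the average per-round regret of $(b_t)$ relative to $(b_t^* )$, all as defined in the context. Let $V_T$ be the expected variational distance between the kernels of $P$ and $Q$ as defined in the context, and let $D(P\|Q)$ be the Kullback-Leibler divergence. Then for every $\delta\in(0,1]$, each of the following two inequalities holds with probability at least $1-\delta$ over $P$: $$\Delta < 4L\,V_T\cdot\frac{1}{\delta}+\frac{2\sqrt{2}\,L}{\sqrt{T}}\sqrt{\log\frac{2}{\delta}},$$ $$\Delta < 2L\sqrt{\frac{D(P\|Q)}{T}}\cdot\frac{1}{\sqrt{\delta}}+\frac{2\sqrt{2}\,L}{\sqrt{T}}\sqrt{\log\frac{2}{\delta}}.$$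
   Context: Kernels: For $S\subseteq\{1,\dots,T\}$, $P_S$ denotes the marginal of $P$ on the coordinates in $S$, and $[t]=\{1,\dots,t\}$. It is assumed that for every $t\in\{2,\dots,T\}$ there is a Markov kernel $K_P^{(t)}:\mathcal{Z}^{t-1}\times\mathscr{G}\to[0,1]$ such that for all $G_1,\dots,G_t\in\mathscr{G}$ $$P_{[t]}(G_1\times\dots\times G_t)=\int_{G_1\times\dots\times G_{t-1}}K_P^{(t)}(z_1,\dots,z_{t-1},G_t)\,P_{[t-1]}(dz_1,\dots,dz_{t-1}),$$ and $K_P^{(1)}:=P_{\{1\}}$. The same is assumed for $Q$, with kernels $K_Q^{(t)}$. These kernels are fixed. Policies: A policy is a family of measurable functions from $\mathcal{Z}^{t-1}$ to $\mathcal{B}$, $t=1,\dots,T$ (for $t=1$ the argument is the empty tuple). A policy $(b_t)$ is $Q$-optimal if for every $t$ and all $z_1,\dots,z_{t-1}\in\mathcal{Z}$ $$b_t(z_1,\dots,z_{t-1})\in\operatorname*{arg\,min}_{b\in\mathcal{B}}\int_{\mathcal{Z}}\ell(b,z)\,K_Q^{(t)}(z_1,\dots,z_{t-1},dz),$$ and $P$-optimality of $(b^*_t)$ is defined the same way with $K_P^{(t)}$ in place of $K_Q^{(t)}$. Measurable policies of both kinds are assumed to exist, and fixed choices are made. Regret: With $B_t:=b_t(Z_1,\dots,Z_{t-1})$ and $B_t^*:=b_t^*(Z_1,\dots,Z_{t-1})$, $$\Delta:=\frac1T\sum_{t=1}^T\big(\ell(B_t,Z_t)-\ell(B_t^*,Z_t)\big).$$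 Distances: $\|\mu-\nu\|_{\mathrm{TV}}:=\sup_{F}|\mu(F)-\nu(F)|$ over measurable sets $F$ (no factor $1/2$ or $2$). Put $v_t:=\|K_P^{(t)}(Z_1,\dots,Z_{t-1},\cdot)-K_Q^{(t)}(Z_1,\dots,Z_{t-1},\cdot)\|_{\mathrm{TV}}$, which is taken to be a random variable (i.e. measurable), and $V_T:=\mathbb{E}_P\big[\frac1T\sum_{t=1}^T v_t\big]$. $D(P\|Q):=\mathbb{E}_P\log\frac{dP}{dQ}$ if $P\ll Q$ and $D(P\|Q):=\infty$ otherwise. All logarithms are natural.
   Formalization: The formal theorem assumes L > 0 instead of L ∈ [0,∞) (and T ≥ 1): for L = 0 the regret Δ and, for finite D(P‖Q), both right-hand sides are 0, so the strict inequalities fail for every δ < 1. *)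

theory Defs
  imports "HOL-Probability.Probability"
begin

text \<open>
  A point of the \<open>n\<close>-fold product of \<open>Z\<close> is a function on the index set \<open>{1..n}\<close> that is
  \<open>undefined\<close> elsewhere. The history before round \<open>t\<close> is indexed by \<open>{1..<t}\<close>, so for
  \<open>t = 1\<close> it is the single point \<open>\<lambda>_. undefined\<close> (the empty tuple).
\<close>

abbreviation seq_space :: "nat set \<Rightarrow> 'z measure \<Rightarrow> (nat \<Rightarrow> 'z) measure" where
  "seq_space S Z \<equiv> PiM S (\<lambda>_. Z)"

definition marginal :: "'z measure \<Rightarrow> (nat \<Rightarrow> 'z) measure \<Rightarrow> nat set \<Rightarrow> (nat \<Rightarrow> 'z) measure" where
  "marginal Z P S = distr P (seq_space S Z) (\<lambda>\<omega>. restrict \<omega> S)"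

definition hist :: "(nat \<Rightarrow> 'z) \<Rightarrow> nat \<Rightarrow> (nat \<Rightarrow> 'z)" where
  "hist \<omega> t = restrict \<omega> {1..<t}"

text \<open>
  \<open>K t h\<close> is the conditional law of coordinate \<open>t\<close> given the history \<open>h\<close>. Measurability
  into \<open>prob_algebra Z\<close> says exactly that \<open>K t\<close> is a Markov kernel from histories to \<open>Z\<close>.
  The third conjunct identifies \<open>K 1\<close>, evaluated at the empty tuple, with the law of the
  first coordinate.
\<close>

definition disintegrates ::
  "nat \<Rightarrow> 'z measure \<Rightarrow> (nat \<Rightarrow> 'z) measure \<Rightarrow> (nat \<Rightarrow> (nat \<Rightarrow> 'z) \<Rightarrow> 'z measure) \<Rightarrow> bool" where
  "disintegrates T Z P K \<longleftrightarrow>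
     (\<forall>t\<in>{1..T}. K t \<in> seq_space {1..<t} Z \<rightarrow>\<^sub>M prob_algebra Z) \<and>
     (\<forall>t\<in>{2..T}. \<forall>G \<in> {1..t} \<rightarrow> sets Z.
        emeasure (marginal Z P {1..t}) (Pi\<^sub>E {1..t} G) =
        (\<integral>\<^sup>+ h \<in> Pi\<^sub>E {1..<t} G. emeasure (K t h) (G t) \<partial>marginal Z P {1..<t})) \<and>
     K 1 (\<lambda>_. undefined) = distr P Z (\<lambda>\<omega>. \<omega> 1)"

definition measurable_policy ::
  "nat \<Rightarrow> 'z measure \<Rightarrow> 'b measure \<Rightarrow> (nat \<Rightarrow> (nat \<Rightarrow> 'z) \<Rightarrow> 'b) \<Rightarrow> bool" where
  "measurable_policy T Z B b \<longleftrightarrow> (\<forall>t\<in>{1..T}. b t \<in> seq_space {1..<t} Z \<rightarrow>\<^sub>M B)"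

definition optimal_policy ::
  "nat \<Rightarrow> 'z measure \<Rightarrow> 'b measure \<Rightarrow> ('b \<Rightarrow> 'z \<Rightarrow> real) \<Rightarrow>
   (nat \<Rightarrow> (nat \<Rightarrow> 'z) \<Rightarrow> 'z measure) \<Rightarrow> (nat \<Rightarrow> (nat \<Rightarrow> 'z) \<Rightarrow> 'b) \<Rightarrow> bool" where
  "optimal_policy T Z B l K b \<longleftrightarrow>
     (\<forall>t\<in>{1..T}. \<forall>h\<in>space (seq_space {1..<t} Z).
        is_arg_min (\<lambda>a. \<integral>z. l a z \<partial>K t h) (\<lambda>a. a \<in> space B) (b t h))"

definition avg_regret ::
  "nat \<Rightarrow> ('b \<Rightarrow> 'z \<Rightarrow> real) \<Rightarrow> (nat \<Rightarrow> (nat \<Rightarrow> 'z) \<Rightarrow> 'b) \<Rightarrow> (nat \<Rightarrow> (nat \<Rightarrow> 'z) \<Rightarrow> 'b) \<Rightarrow>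
   (nat \<Rightarrow> 'z) \<Rightarrow> real" where
  "avg_regret T l b b' \<omega> =
     (1 / real T) * (\<Sum>t = 1..T. l (b t (hist \<omega> t)) (\<omega> t) - l (b' t (hist \<omega> t)) (\<omega> t))"

definition tv_dist :: "'a measure \<Rightarrow> 'a measure \<Rightarrow> real" where
  "tv_dist \<mu> \<nu> = (SUP F\<in>sets \<mu>. \<bar>measure \<mu> F - measure \<nu> F\<bar>)"

definition kernel_dist ::
  "(nat \<Rightarrow> (nat \<Rightarrow> 'z) \<Rightarrow> 'z measure) \<Rightarrow> (nat \<Rightarrow> (nat \<Rightarrow> 'z) \<Rightarrow> 'z measure) \<Rightarrow>
   nat \<Rightarrow> (nat \<Rightarrow> 'z) \<Rightarrow> real" where
  "kernel_dist KP KQ t \<omega> = tv_dist (KP t (hist \<omega> t)) (KQ t (hist \<omega> t))"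

definition expected_kernel_dist ::
  "nat \<Rightarrow> (nat \<Rightarrow> 'z) measure \<Rightarrow> (nat \<Rightarrow> (nat \<Rightarrow> 'z) \<Rightarrow> 'z measure) \<Rightarrow>
   (nat \<Rightarrow> (nat \<Rightarrow> 'z) \<Rightarrow> 'z measure) \<Rightarrow> real" where
  "expected_kernel_dist T P KP KQ = (\<integral>\<omega>. (1 / real T) * (\<Sum>t = 1..T. kernel_dist KP KQ t \<omega>) \<partial>P)"

text \<open>
  The library's \<open>KL_divergence\<close> is a real-valued Bochner integral, hence \<open>0\<close> when the
  log-density is not integrable. Here the expectation is taken in the extended reals, as
  positive part minus negative part; the negative part is always finite, so the value is
  \<open>\<infinity>\<close> exactly when \<open>P\<close> is not absolutely continuous with respect to \<open>Q\<close> or the positive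
  part diverges. Note the order of arguments: \<open>entropy_density (exp 1) Q P\<close> is
  \<open>ln (dP/dQ)\<close> and \<open>absolutely_continuous Q P\<close> means \<open>P \<lless> Q\<close>.
\<close>

definition kl_div :: "'a measure \<Rightarrow> 'a measure \<Rightarrow> ereal" where
  "kl_div P Q =
     (if absolutely_continuous Q P
      then enn2ereal (\<integral>\<^sup>+ x. ennreal (entropy_density (exp 1) Q P x) \<partial>P)
         - enn2ereal (\<integral>\<^sup>+ x. ennreal (- entropy_density (exp 1) Q P x) \<partial>P)
      else \<infinity>)"

lemma kl_div_eq_KL_divergence:
  assumes "absolutely_continuous Q P" "integrable P (entropy_density (exp 1) Q P)"
  shows "kl_div P Q = ereal (KL_divergence (exp 1) Q P)"
proof -
  let ?f = "entropy_density (exp 1) Q P"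
  have "(\<integral>\<^sup>+ x. ennreal (?f x) \<partial>P) \<noteq> \<infinity>" "(\<integral>\<^sup>+ x. ennreal (- ?f x) \<partial>P) \<noteq> \<infinity>"
    using assms(2) by (simp_all add: real_integrable_def)
  then obtain a b where "(\<integral>\<^sup>+ x. ennreal (?f x) \<partial>P) = ennreal a" "0 \<le> a"
    "(\<integral>\<^sup>+ x. ennreal (- ?f x) \<partial>P) = ennreal b" "0 \<le> b"
    by (metis ennreal_cases infinity_ennreal_def)
  then show ?thesis
    using assms by (simp add: kl_div_def KL_divergence_def real_lebesgue_integral_def)
qed

definition ereal_sqrt :: "ereal \<Rightarrow> ereal" where
  "ereal_sqrt x = (case x of ereal r \<Rightarrow> ereal (sqrt r) | PInfty \<Rightarrow> PInfty | MInfty \<Rightarrow> MInfty)"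

end

theory Submission
  imports Defs
begin

text \<open>
  Let \<open>g\<^sub>t(h, z) = l(b\<^sub>t(h), z) - l(b\<^sup>*\<^sub>t(h), z)\<close>, so that \<open>\<bar>g\<^sub>t\<bar> \<le> L\<close>, and let \<open>N\<^sub>t(h)\<close> be the difference
  of the integrals of \<open>g\<^sub>t(h, \<cdot>)\<close> under the two kernels. By \<open>Q\<close>-optimality, the conditional mean of
  the regret in round \<open>t\<close> is at most \<open>N\<^sub>t\<close>, and the centred regret is controlled by Azuma--Hoeffding.
  It remains to apply Markov's inequality to an upper bound for the average of the \<open>N\<^sub>t\<close>. For the
  first inequality, \<open>N\<^sub>t \<le> 2 L v\<^sub>t\<close>.

  For the second one, the chain rule for relative entropy and Pinsker's inequality suggest
  \<open>\<Sum>\<^sub>t E\<^sub>P N\<^sub>t\<^sup>2 \<le> 2 L\<^sup>2 D(P\<parallel>Q)\<close>. If the \<open>\<sigma>\<close>-algebra of \<open>Z\<close> is not countably generated, the kernels need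
  not have densities with respect to each other (\<open>P = Q\<close> is compatible with \<open>v\<^sub>t = 1/2\<close> for all \<open>t \<ge> 2\<close>), so this is not
  derived from \<open>v\<^sub>t\<close>. Instead, the Donsker--Varadhan inequality is applied to the exponential
  supermartingale under \<open>Q\<close> with the predictable weights \<open>N\<^sub>t / L\<^sup>2\<close>. The same supermartingale,
  under \<open>P\<close> and with constant weights, yields Azuma--Hoeffding.
\<close>

subsection \<open>Total variation and relative entropy\<close>

lemma
  assumes "prob_space M" "prob_space N"
  shows abs_measure_diff_le_tv_dist: "F \<in> sets M \<Longrightarrow> \<bar>measure M F - measure N F\<bar> \<le> tv_dist M N"
    and tv_dist_nonneg: "0 \<le> tv_dist M N"
    and tv_dist_le_1: "tv_dist M N \<le> 1"
proof -
  interpret M: prob_space M by fact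
  interpret N: prob_space N by fact
  have le_1: "\<bar>measure M F - measure N F\<bar> \<le> 1" for F
    by (smt (verit) M.prob_le_1 N.prob_le_1 measure_nonneg)
  then have bdd: "bdd_above ((\<lambda>F. \<bar>measure M F - measure N F\<bar>) ` sets M)"
    by (intro bdd_aboveI2)
  show *: "\<bar>measure M F - measure N F\<bar> \<le> tv_dist M N" if "F \<in> sets M" for F
    unfolding tv_dist_def using that bdd by (rule cSUP_upper)
  show "0 \<le> tv_dist M N" using *[of "{}"] by simp
  show "tv_dist M N \<le> 1"
    unfolding tv_dist_def by (intro cSUP_least le_1) auto
qed

text \<open>Layer-cake argument: the integral of \<open>f\<close> is the integral over the levels
  \<open>s\<close> in \<open>{0..c}\<close> of the measure of \<open>{s < f}\<close>, and at each
  level the two measures differ by at most the total variation distance. The constant is thus the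
  length of the range of \<open>f\<close>.\<close>

lemma integral_diff_le_tv_dist:
  assumes "prob_space M" "prob_space N" and sets [measurable_cong]: "sets N = sets M"
    and f [measurable]: "f \<in> borel_measurable M"
    and bnd: "\<And>x. x \<in> space M \<Longrightarrow> 0 \<le> f x \<and> f x \<le> c"
  shows "(\<integral>x. f x \<partial>M) - (\<integral>x. f x \<partial>N) \<le> c * tv_dist M N"
proof -
  interpret M: prob_space M by fact
  interpret N: prob_space N by fact
  obtain x0 where "x0 \<in> space M" using M.not_empty by auto
  then have c: "0 \<le> c" using bnd[of x0] by linarith
  have spN: "space N = space M" using sets by (rule sets_eq_imp_space_eq)
  define d where "d = tv_dist M N"
  have d: "\<bar>measure M F - measure N F\<bar> \<le> d" if "F \<in> sets M" for F
    unfolding d_def using assms(1,2) that by (rule abs_measure_diff_le_tv_dist)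
  have d0: "0 \<le> d" unfolding d_def using assms(1,2) by (rule tv_dist_nonneg)
  \<comment> \<open>\<open>R\<close> is kept general because the formula is needed for both
    \<open>M\<close> and \<open>N\<close>. The condition \<open>s < f x\<close> is written as an
    indicator at \<open>f x - s\<close>, which makes its joint measurability evident for
    Fubini.\<close>
  have layer: "(\<integral>\<^sup>+x. ennreal (f x) \<partial>R) =
      (\<integral>\<^sup>+s. indicator {0..c} s * emeasure R {x \<in> space R. s < f x} \<partial>lborel)"
    if "prob_space R" and [measurable_cong]: "sets R = sets M" for R
  proof -
    interpret R: prob_space R by fact
    interpret pair_sigma_finite R lborel ..
    have spR: "space R = space M" using that(2) by (rule sets_eq_imp_space_eq)
    have "(\<integral>\<^sup>+x. ennreal (f x) \<partial>R) =
        (\<integral>\<^sup>+x. \<integral>\<^sup>+s. indicator {0..c} s * indicator {0<..} (f x - s) \<partial>lborel \<partial>R)"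
    proof (rule nn_integral_cong)
      fix x assume "x \<in> space R"
      then have "0 \<le> f x" "f x \<le> c" using bnd spR by auto
      have "(\<integral>\<^sup>+s. indicator {0..c} s * indicator {0<..} (f x - s) \<partial>lborel)
          = (\<integral>\<^sup>+s. indicator {0..<f x} s \<partial>lborel)"
        using \<open>f x \<le> c\<close> by (intro nn_integral_cong) (auto simp: indicator_def)
      then show "ennreal (f x) = (\<integral>\<^sup>+s. indicator {0..c} s * indicator {0<..} (f x - s) \<partial>lborel)"
        using \<open>0 \<le> f x\<close> by simp
    qed
    also have "\<dots> = (\<integral>\<^sup>+s. \<integral>\<^sup>+x. indicator {0..c} s * indicator {0<..} (f x - s) \<partial>R \<partial>lborel)"
      by (rule Fubini'[symmetric]) measurable
    also have "\<dots> = (\<integral>\<^sup>+s. indicator {0..c} s * emeasure R {x \<in> space R. s < f x} \<partial>lborel)"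
    proof (rule nn_integral_cong)
      fix s :: real
      have "(\<integral>\<^sup>+x. indicator {0..c} s * indicator {0<..} (f x - s) \<partial>R)
          = (\<integral>\<^sup>+x. indicator {0..c} s * indicator {x \<in> space R. s < f x} x \<partial>R)"
        by (intro nn_integral_cong) (auto simp: indicator_def)
      also have "\<dots> = indicator {0..c} s * emeasure R {x \<in> space R. s < f x}"
        by (subst nn_integral_cmult) auto
      finally show "(\<integral>\<^sup>+x. indicator {0..c} s * indicator {0<..} (f x - s) \<partial>R) = \<dots>" .
    qed
    finally show ?thesis .
  qed
  have int: "integrable M f" "integrable N f"
    using bnd spN by (auto intro!: M.integrable_const_bound[where B=c] N.integrable_const_bound[where B=c] AE_I2)
  have "(\<integral>\<^sup>+x. ennreal (f x) \<partial>M) \<le>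
      (\<integral>\<^sup>+s. indicator {0..c} s * emeasure N {x \<in> space N. s < f x} + ennreal d * indicator {0..c} s \<partial>lborel)"
    unfolding layer[OF \<open>prob_space M\<close> refl]
  proof (rule nn_integral_mono)
    fix s :: real
    have "emeasure M {x \<in> space M. s < f x} \<le> emeasure N {x \<in> space N. s < f x} + ennreal d"
      using d[of "{x \<in> space M. s < f x}"] d0 spN
      by (simp add: M.emeasure_eq_measure N.emeasure_eq_measure flip: ennreal_plus)
    then show "indicator {0..c} s * emeasure M {x \<in> space M. s < f x} \<le>
        indicator {0..c} s * emeasure N {x \<in> space N. s < f x} + ennreal d * indicator {0..c} s"
      by (auto simp: indicator_def)
  qed
  also have "\<dots> = (\<integral>\<^sup>+x. ennreal (f x) \<partial>N) + ennreal d * ennreal c"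
  proof -
    have "(\<lambda>s. emeasure N {x \<in> space N. s < f x}) \<in> borel_measurable lborel"
    proof -
      have *: "{p \<in> space (lborel \<Otimes>\<^sub>M N). fst p < f (snd p)} \<in> sets (lborel \<Otimes>\<^sub>M N)"
        by measurable
      show ?thesis
        using N.measurable_emeasure_Pair[OF *] by (simp add: space_pair_measure vimage_def)
    qed
    then show ?thesis
      unfolding layer[OF \<open>prob_space N\<close> sets]
      using c by (subst nn_integral_add) (auto simp: nn_integral_cmult_indicator)
  qed
  finally have *: "(\<integral>\<^sup>+x. ennreal (f x) \<partial>M) \<le> (\<integral>\<^sup>+x. ennreal (f x) \<partial>N) + ennreal d * ennreal c" .
  have "ennreal (\<integral>x. f x \<partial>M) \<le> ennreal (\<integral>x. f x \<partial>N) + ennreal d * ennreal c"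
  proof -
    have "(\<integral>\<^sup>+x. ennreal (f x) \<partial>M) = ennreal (\<integral>x. f x \<partial>M)"
      "(\<integral>\<^sup>+x. ennreal (f x) \<partial>N) = ennreal (\<integral>x. f x \<partial>N)"
      using bnd spN int by (auto intro!: nn_integral_eq_integral)
    with * show ?thesis by simp
  qed
  moreover have N0: "0 \<le> (\<integral>x. f x \<partial>N)"
    using bnd spN by (auto intro!: Bochner_Integration.integral_nonneg)
  ultimately have "ennreal (\<integral>x. f x \<partial>M) \<le> ennreal ((\<integral>x. f x \<partial>N) + d * c)"
    using d0 c by (simp add: ennreal_mult)
  then have "(\<integral>x. f x \<partial>M) \<le> (\<integral>x. f x \<partial>N) + d * c"
    using N0 d0 c by (subst (asm) ennreal_le_iff) auto
  then show ?thesis by (simp add: d_def mult.commute)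
qed

text \<open>Donsker--Varadhan inequality, normalised. With \<open>f\<close> the density of
  \<open>P\<close> with respect to \<open>Q\<close>, the bound \<open>ln y \<le> y - 1\<close> at
  \<open>y = exp (u x) / f x\<close> gives \<open>u x - ln (f x) \<le> exp (u x) / f x - 1\<close>.
  Under \<open>P\<close> the right-hand side has nonpositive mean, since dividing by
  \<open>f\<close> turns the \<open>P\<close>-integral of \<open>exp u / f\<close> into at most the
  \<open>Q\<close>-integral of \<open>exp u\<close>.\<close>

lemma integral_le_kl_div:
  assumes P: "prob_space P" and Q: "prob_space Q" and sets: "sets P = sets Q"
    and u: "u \<in> borel_measurable Q" and bnd: "\<And>x. x \<in> space Q \<Longrightarrow> \<bar>u x\<bar> \<le> c"
    and le_1: "(\<integral>\<^sup>+x. ennreal (exp (u x)) \<partial>Q) \<le> 1"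
  shows "ereal (\<integral>x. u x \<partial>P) \<le> kl_div P Q"
proof (cases "absolutely_continuous Q P \<and> (\<integral>\<^sup>+x. ennreal (entropy_density (exp 1) Q P x) \<partial>P) \<noteq> \<infinity>")
  case False
  \<comment> \<open>If the positive part diverges, the definition reads infinity minus something,
    which in \<open>ereal\<close> is infinity whatever is subtracted.\<close>
  then have "kl_div P Q = \<infinity>" by (auto simp: kl_div_def)
  then show ?thesis by simp
next
  case True
  interpret P: prob_space P by fact
  interpret Q: prob_space Q by fact
  note [measurable_cong] = sets
  note [measurable] = u
  define r where "r = RN_deriv Q P"
  define f where "f = (\<lambda>x. enn2real (r x))"
  define e where "e = entropy_density (exp 1) Q P"
  have [measurable]: "r \<in> borel_measurable Q" "f \<in> borel_measurable Q" "e \<in> borel_measurable Q"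
    unfolding r_def f_def e_def by measurable
  have e: "e x = ln (f x)" for x
    by (simp add: e_def f_def r_def entropy_density_def log_def)
  have dens: "P = density Q r"
    unfolding r_def using True sets by (simp add: Q.density_RN_deriv)
  have fin: "AE x in Q. r x \<noteq> \<infinity>"
    unfolding r_def using True sets by (intro Q.RN_deriv_finite P.sigma_finite_measure_axioms) auto
  have pos: "AE x in P. 0 < f x"
    unfolding dens using fin
    by (subst AE_density) (auto simp: f_def enn2real_positive_iff less_top pos2)
  \<comment> \<open>Where \<open>r\<close> is zero or infinite, \<open>f\<close> is zero and
    division by zero gives zero, so the left integrand vanishes there; elsewhere the density
    cancels. Hence an inequality and not an equation.\<close>
  have div_le: "(\<integral>\<^sup>+x. ennreal (w x / f x) \<partial>P) \<le> (\<integral>\<^sup>+x. ennreal (w x) \<partial>Q)"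
    if [measurable]: "w \<in> borel_measurable Q" and w: "\<And>x. 0 \<le> w x" for w
  proof -
    have "(\<integral>\<^sup>+x. ennreal (w x / f x) \<partial>P) = (\<integral>\<^sup>+x. r x * ennreal (w x / f x) \<partial>Q)"
      unfolding dens by (rule nn_integral_density) measurable
    also have "\<dots> \<le> (\<integral>\<^sup>+x. ennreal (w x) \<partial>Q)"
    proof (rule nn_integral_mono)
      fix x
      show "r x * ennreal (w x / f x) \<le> ennreal (w x)"
        using w[of x] by (cases "r x") (auto simp: f_def simp flip: ennreal_mult)
    qed
    finally show ?thesis .
  qed
  \<comment> \<open>The negative part of the log-density is dominated by \<open>1 / f\<close>, whose
    \<open>P\<close>-integral is at most the total mass of \<open>Q\<close>. With the case
    assumption on the positive part, \<open>e\<close> becomes integrable.\<close>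
  have "(\<integral>\<^sup>+x. ennreal (- e x) \<partial>P) \<le> (\<integral>\<^sup>+x. ennreal (1 / f x) \<partial>P)"
  proof (rule nn_integral_mono_AE, use pos in eventually_elim)
    fix x assume "0 < f x"
    then have "- ln (f x) \<le> 1 / f x"
      using ln_le_minus_one[of "1 / f x"] by (simp add: ln_div)
    then show "ennreal (- e x) \<le> ennreal (1 / f x)" by (simp add: e ennreal_leI)
  qed
  also have "\<dots> \<le> 1"
    using div_le[of "\<lambda>_. 1"] by (simp add: Q.emeasure_space_1)
  finally have "(\<integral>\<^sup>+x. ennreal (- e x) \<partial>P) \<noteq> \<infinity>"
    by (auto simp: top_unique)
  then have int_e: "integrable P e"
    using True by (simp add: real_integrable_def e_def)
  have spP: "space P = space Q" using sets by (rule sets_eq_imp_space_eq)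
  have int_u: "integrable P u"
    by (rule P.integrable_const_bound[where B=c]) (use bnd spP in auto)
  have le: "(\<integral>\<^sup>+x. ennreal (exp (u x) / f x) \<partial>P) \<le> 1"
    using div_le[of "\<lambda>x. exp (u x)"] le_1 by simp
  have f0: "0 \<le> f x" for x by (simp add: f_def)
  have int: "integrable P (\<lambda>x. exp (u x) / f x)"
    by (rule integrableI_nonneg) (use le f0 in \<open>auto simp: top_unique le_less_trans[OF le]\<close>)
  have "(\<integral>x. u x \<partial>P) - (\<integral>x. e x \<partial>P) = (\<integral>x. u x - e x \<partial>P)"
    using int_u int_e by simp
  also have "\<dots> \<le> (\<integral>x. exp (u x) / f x - 1 \<partial>P)"
  proof (rule integral_mono_AE)
    show "AE x in P. u x - e x \<le> exp (u x) / f x - 1"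
      using pos
    proof eventually_elim
      fix x assume "0 < f x"
      then show "u x - e x \<le> exp (u x) / f x - 1"
        using ln_le_minus_one[of "exp (u x) / f x"] by (simp add: ln_div e)
    qed
  qed (use int int_u int_e in auto)
  also have "\<dots> = (\<integral>x. exp (u x) / f x \<partial>P) - 1"
    using int by (simp add: P.prob_space)
  also have "\<dots> \<le> 0"
    using le f0 by (subst (asm) nn_integral_eq_integral[OF int]) auto
  finally have "(\<integral>x. u x \<partial>P) \<le> (\<integral>x. e x \<partial>P)" by simp
  moreover have "kl_div P Q = ereal (\<integral>x. e x \<partial>P)"
    using kl_div_eq_KL_divergence[of Q P] True int_e by (simp add: e_def KL_divergence_def)
  ultimately show ?thesis by simp
qed

subsection \<open>Sequential disintegration\<close>

lemma measurable_hist [measurable]: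
  "{1..<t} \<subseteq> S \<Longrightarrow> (\<lambda>\<omega>. hist \<omega> t) \<in> seq_space S Z \<rightarrow>\<^sub>M seq_space {1..<t} Z"
  unfolding hist_def by (rule measurable_restrict_subset)

lemma fun_upd_in_PiE_insert_iff:
  assumes "t \<notin> J" "h \<in> extensional J"
  shows "h(t := z) \<in> Pi\<^sub>E (insert t J) G \<longleftrightarrow> h \<in> Pi\<^sub>E J G \<and> z \<in> G t"
proof -
  have "h(t := z) \<in> extensional (insert t J)"
    using assms(2) by (auto simp: extensional_def)
  moreover have "(\<forall>i\<in>J. (h(t := z)) i \<in> G i) \<longleftrightarrow> (\<forall>i\<in>J. h i \<in> G i)"
    using assms(1) by (metis fun_upd_other)
  ultimately show ?thesis
    using assms(2) by (simp only: PiE_iff Set.ball_simps fun_upd_same) blast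
qed

lemma prob_space_marginal:
  assumes "prob_space P" "sets P = sets (seq_space I Z)" "S \<subseteq> I"
  shows "prob_space (marginal Z P S)"
proof -
  have "(\<lambda>\<omega>. restrict \<omega> S) \<in> P \<rightarrow>\<^sub>M seq_space S Z"
    using measurable_restrict_subset[OF \<open>S \<subseteq> I\<close>] assms(2) by (simp cong: measurable_cong_sets)
  then show ?thesis
    unfolding marginal_def using assms(1) by (rule prob_space.prob_space_distr[rotated])
qed

lemma disintegratesD_measurable:
  assumes "disintegrates T Z P K" "t \<in> {1..T}"
  shows "K t \<in> seq_space {1..<t} Z \<rightarrow>\<^sub>M prob_algebra Z"
  using assms unfolding disintegrates_def by blast

lemma disintegratesD_kernel:
  assumes "disintegrates T Z P K" "t \<in> {1..T}" "h \<in> space (seq_space {1..<t} Z)"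
  shows "prob_space (K t h)" "sets (K t h) = sets Z" "space (K t h) = space Z"
  using measurable_space[OF disintegratesD_measurable[OF assms(1,2)] assms(3)]
  by (auto simp: space_prob_algebra dest: sets_eq_imp_space_eq)

text \<open>\<open>disintegrates\<close> gives the rectangle identity from \<open>t = 2\<close> on.
  For \<open>t = 1\<close> the history space is one point of mass 1, and the identity reduces to the
  prescribed value of \<open>K 1\<close> at that point.\<close>

lemma emeasure_marginal_rectangle:
  assumes P: "prob_space P" "sets P = sets (seq_space {1..T} Z)"
    and K: "disintegrates T Z P K" and t: "t \<in> {1..T}" and G: "\<And>i. i \<in> {1..t} \<Longrightarrow> G i \<in> sets Z"
  shows "emeasure (marginal Z P {1..t}) (Pi\<^sub>E {1..t} G) =
    (\<integral>\<^sup>+h \<in> Pi\<^sub>E {1..<t} G. emeasure (K t h) (G t) \<partial>marginal Z P {1..<t})"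
proof (cases "t = 1")
  case False
  then show ?thesis using K t G unfolding disintegrates_def by auto
next
  case True
  interpret prob_space P by fact
  interpret M: prob_space "marginal Z P {}"
    by (rule prob_space_marginal[OF P]) simp
  have T: "1 \<in> {1..T}" "{1..1} \<subseteq> {1..T}" using t True by simp_all
  have m: "(\<lambda>\<omega>. \<omega> 1) \<in> P \<rightarrow>\<^sub>M Z" "(\<lambda>\<omega>. restrict \<omega> {1..1}) \<in> P \<rightarrow>\<^sub>M seq_space {1..1} Z"
    unfolding measurable_cong_sets[OF P(2) refl]
    using measurable_component_singleton[OF T(1), of "\<lambda>_. Z"] measurable_restrict_subset[OF T(2)] by simp_all
  have G1: "G 1 \<in> sets Z" using G[of 1] True by simp
  have K1: "K 1 (\<lambda>_. undefined) = distr P Z (\<lambda>\<omega>. \<omega> 1)"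
    using K unfolding disintegrates_def by blast
  have "emeasure (marginal Z P {1..1}) (Pi\<^sub>E {1..1} G) =
      emeasure P ((\<lambda>\<omega>. restrict \<omega> {1..1}) -` Pi\<^sub>E {1..1} G \<inter> space P)"
    unfolding marginal_def using G True
    by (intro emeasure_distr m sets_PiM_I_finite) auto
  also have "(\<lambda>\<omega>. restrict \<omega> {1..1}) -` Pi\<^sub>E {1..1} G \<inter> space P = (\<lambda>\<omega>. \<omega> 1) -` G 1 \<inter> space P"
    by auto
  also have "emeasure P \<dots> = emeasure (K 1 (\<lambda>_. undefined)) (G 1)"
    unfolding K1 by (rule emeasure_distr[OF m(1) G1, symmetric])
  also have "\<dots> = (\<integral>\<^sup>+h. emeasure (K 1 (\<lambda>_. undefined)) (G 1) \<partial>marginal Z P {})"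
    by (simp add: M.emeasure_space_1)
  also have "\<dots> = (\<integral>\<^sup>+h \<in> Pi\<^sub>E {1..<1} G. emeasure (K 1 h) (G 1) \<partial>marginal Z P {})"
    by (intro nn_integral_cong) (auto simp: marginal_def space_PiM)
  finally show ?thesis using True by simp
qed

text \<open>Extends the hypothesis from rectangles to the full joint law of history and next
  coordinate. The marginal on \<open>{1..t}\<close> and the law obtained by appending a draw from
  the kernel to a random history agree on rectangles, hence everywhere; splitting a sequence into
  history and last coordinate then transports this to the product.\<close>

lemma distr_hist_coordinate:
  assumes P: "prob_space P" "sets P = sets (seq_space {1..T} Z)"
    and K: "disintegrates T Z P K" and t: "t \<in> {1..T}"
  defines "H \<equiv> seq_space {1..<t} Z"
  shows "distr P (H \<Otimes>\<^sub>M Z) (\<lambda>\<omega>. (hist \<omega> t, \<omega> t)) =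
    distr P H (\<lambda>\<omega>. hist \<omega> t) \<bind> (\<lambda>h. distr (K t h) (H \<Otimes>\<^sub>M Z) (Pair h))"
proof -
  interpret prob_space P by fact
  have sub: "{1..<t} \<subseteq> {1..T}" "{1..t} \<subseteq> {1..T}" and I: "{1..t} = {1..<t} \<union> {t}" and t': "t \<in> {1..t}"
    using t by auto
  note [measurable] = measurable_prob_algebraD[OF disintegratesD_measurable[OF K t], folded H_def]
  have [measurable]: "(\<lambda>\<omega>. hist \<omega> t) \<in> seq_space {1..t} Z \<rightarrow>\<^sub>M H"
    unfolding H_def by (rule measurable_hist) (use I in auto)
  have [measurable]: "(\<lambda>\<omega>. \<omega> t) \<in> seq_space {1..t} Z \<rightarrow>\<^sub>M Z"
    by (rule measurable_component_singleton[OF t', of "\<lambda>_. Z"])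
  have pair: "(\<lambda>\<omega>. (hist \<omega> t, \<omega> t)) \<in> seq_space {1..t} Z \<rightarrow>\<^sub>M H \<Otimes>\<^sub>M Z"
    by measurable
  have restr: "(\<lambda>\<omega>. restrict \<omega> {1..t}) \<in> P \<rightarrow>\<^sub>M seq_space {1..t} Z"
    unfolding measurable_cong_sets[OF P(2) refl] by (rule measurable_restrict_subset[OF sub(2)])
  have U [measurable]: "(\<lambda>(h, z). h(t := z)) \<in> H \<Otimes>\<^sub>M Z \<rightarrow>\<^sub>M seq_space {1..t} Z"
    unfolding H_def split_def by (rule measurable_fun_upd[OF I]) measurable
  have upd: "(\<lambda>z. h(t := z)) \<in> K t h \<rightarrow>\<^sub>M seq_space {1..t} Z" if h: "h \<in> space H" for h
    unfolding measurable_cong_sets[OF disintegratesD_kernel(2)[OF K t h[unfolded H_def]] refl]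
    using measurable_Pair2[OF U h] by simp
  have marg: "marginal Z P {1..<t} = distr P H (\<lambda>\<omega>. hist \<omega> t)"
    by (simp add: marginal_def H_def hist_def)
  interpret M: prob_space "marginal Z P {1..<t}"
    by (rule prob_space_marginal[OF P sub(1)])
  have sets_marg [measurable_cong]: "sets (marginal Z P {1..<t}) = sets H"
    by (simp add: marginal_def H_def)
  have space_marg: "space (marginal Z P {1..<t}) = space H"
    by (simp add: marginal_def H_def)
  \<comment> \<open>\<open>E h\<close> is the law of the sequence that continues \<open>h\<close> by
    a coordinate drawn from \<open>K t h\<close>. It lives on the same space as the marginal on
    \<open>{1..t}\<close>, so the two can be compared on rectangles.\<close>
  define E where "E = (\<lambda>h. distr (K t h) (seq_space {1..t} Z) (\<lambda>z. h(t := z)))"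
  have E [measurable]: "E \<in> marginal Z P {1..<t} \<rightarrow>\<^sub>M subprob_algebra (seq_space {1..t} Z)"
    unfolding E_def by (rule measurable_distr2[where M=Z]) measurable
  have "marginal Z P {1..t} = marginal Z P {1..<t} \<bind> E"
  proof (rule measure_eqI_PiM_finite[where I="{1..t}" and M="\<lambda>_. Z"])
    show "sets (marginal Z P {1..<t} \<bind> E) = sets (seq_space {1..t} Z)"
      by (rule sets_bind_measurable[OF E M.not_empty])
    fix G assume G: "\<And>i. i \<in> {1..t} \<Longrightarrow> G i \<in> sets Z"
    have "emeasure (marginal Z P {1..<t} \<bind> E) (Pi\<^sub>E {1..t} G) =
        (\<integral>\<^sup>+h. emeasure (E h) (Pi\<^sub>E {1..t} G) \<partial>marginal Z P {1..<t})"
      by (rule emeasure_bind[OF M.not_empty E sets_PiM_I_finite]) (use G in auto)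
    also have "\<dots> = (\<integral>\<^sup>+h \<in> Pi\<^sub>E {1..<t} G. emeasure (K t h) (G t) \<partial>marginal Z P {1..<t})"
    proof (rule nn_integral_cong)
      fix h assume "h \<in> space (marginal Z P {1..<t})"
      then have h: "h \<in> space H" by (simp only: space_marg)
      note k = disintegratesD_kernel[OF K t h[unfolded H_def]]
      have "emeasure (E h) (Pi\<^sub>E {1..t} G)
          = emeasure (K t h) ((\<lambda>z. h(t := z)) -` Pi\<^sub>E {1..t} G \<inter> space (K t h))"
        unfolding E_def using G by (intro emeasure_distr upd[OF h] sets_PiM_I_finite) auto
      also have "(\<lambda>z. h(t := z)) -` Pi\<^sub>E {1..t} G \<inter> space (K t h) =
          (if h \<in> Pi\<^sub>E {1..<t} G then G t else {})"
      proof -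
        have ext: "h \<in> extensional {1..<t}"
          using h by (auto simp: H_def space_PiM PiE_iff)
        have I': "{1..t} = insert t {1..<t}" "t \<notin> {1..<t}" using I by auto
        have "G t \<subseteq> space Z" using G[OF t'] by (rule sets.sets_into_space)
        then show ?thesis
          unfolding I'(1) vimage_def fun_upd_in_PiE_insert_iff[OF I'(2) ext] k(3) by auto
      qed
      finally show "emeasure (E h) (Pi\<^sub>E {1..t} G) =
          emeasure (K t h) (G t) * indicator (Pi\<^sub>E {1..<t} G) h"
        by (simp split: if_splits)
    qed
    finally show "emeasure (marginal Z P {1..t}) (Pi\<^sub>E {1..t} G) =
        emeasure (marginal Z P {1..<t} \<bind> E) (Pi\<^sub>E {1..t} G)"
      using emeasure_marginal_rectangle[OF P K t G] by simp
  next
    interpret M': prob_space "marginal Z P {1..t}"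
      by (rule prob_space_marginal[OF P sub(2)])
    \<comment> \<open>The exhausting sequence of rectangles may be constantly the whole space,
      because the marginal is finite.\<close>
    show "range (\<lambda>_::nat. space (seq_space {1..t} Z)) \<subseteq> prod_algebra {1..t} (\<lambda>_. Z)"
      by (auto simp: space_PiM intro!: prod_algebraI_finite)
    show "emeasure (marginal Z P {1..t}) (space (seq_space {1..t} Z)) \<noteq> \<infinity>" for i :: nat
      unfolding infinity_ennreal_def by (rule M'.emeasure_finite)
  qed (auto simp: marginal_def)
  then have "distr (marginal Z P {1..t}) (H \<Otimes>\<^sub>M Z) (\<lambda>\<omega>. (hist \<omega> t, \<omega> t)) =
      distr (marginal Z P {1..<t} \<bind> E) (H \<Otimes>\<^sub>M Z) (\<lambda>\<omega>. (hist \<omega> t, \<omega> t))"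
    by simp
  also have "\<dots> = marginal Z P {1..<t} \<bind> (\<lambda>h. distr (E h) (H \<Otimes>\<^sub>M Z) (\<lambda>\<omega>. (hist \<omega> t, \<omega> t)))"
    by (rule distr_bind[OF E M.not_empty pair])
  also have "\<dots> = marginal Z P {1..<t} \<bind> (\<lambda>h. distr (K t h) (H \<Otimes>\<^sub>M Z) (Pair h))"
  proof (rule bind_cong[OF refl])
    fix h assume "h \<in> space (marginal Z P {1..<t})"
    then have h: "h \<in> space H" by (simp only: space_marg)
    \<comment> \<open>A history is \<open>undefined\<close> outside \<open>{1..<t}\<close>, and this
      is exactly what restriction puts back at \<open>t\<close> in place of
      \<open>z\<close>.\<close>
    have hh: "hist (h(t := z)) t = h" for z
      using h by (auto simp: hist_def H_def space_PiM PiE_iff extensional_def)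
    show "distr (E h) (H \<Otimes>\<^sub>M Z) (\<lambda>\<omega>. (hist \<omega> t, \<omega> t)) = distr (K t h) (H \<Otimes>\<^sub>M Z) (Pair h)"
      unfolding E_def by (subst distr_distr[OF pair upd[OF h]]) (auto simp: comp_def hh)
  qed
  also have "distr (marginal Z P {1..t}) (H \<Otimes>\<^sub>M Z) (\<lambda>\<omega>. (hist \<omega> t, \<omega> t)) =
      distr P (H \<Otimes>\<^sub>M Z) (\<lambda>\<omega>. (hist (restrict \<omega> {1..t}) t, restrict \<omega> {1..t} t))"
    unfolding marginal_def by (subst distr_distr[OF pair restr]) (simp add: comp_def)
  also have "(\<lambda>\<omega>. (hist (restrict \<omega> {1..t}) t, restrict \<omega> {1..t} t)) = (\<lambda>\<omega>. (hist \<omega> t, \<omega> t))"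
    using t' by (auto simp: hist_def fun_eq_iff restrict_def)
  finally show ?thesis
    unfolding marg .
qed

lemma measurable_hist_pair:
  assumes "sets P = sets (seq_space S Z)" "{1..t} \<subseteq> S" "1 \<le> t"
  shows "(\<lambda>\<omega>. (hist \<omega> t, \<omega> t)) \<in> P \<rightarrow>\<^sub>M seq_space {1..<t} Z \<Otimes>\<^sub>M Z"
    and "(\<lambda>\<omega>. hist \<omega> t) \<in> P \<rightarrow>\<^sub>M seq_space {1..<t} Z"
proof -
  have "{1..<t} \<subseteq> S" "t \<in> S" using assms(2,3) by force+
  then show "(\<lambda>\<omega>. hist \<omega> t) \<in> P \<rightarrow>\<^sub>M seq_space {1..<t} Z"
    unfolding measurable_cong_sets[OF assms(1) refl] by (intro measurable_hist)
  moreover have "(\<lambda>\<omega>. \<omega> t) \<in> P \<rightarrow>\<^sub>M Z"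
    unfolding measurable_cong_sets[OF assms(1) refl]
    using measurable_component_singleton[OF \<open>t \<in> S\<close>, of "\<lambda>_. Z"] .
  ultimately show "(\<lambda>\<omega>. (hist \<omega> t, \<omega> t)) \<in> P \<rightarrow>\<^sub>M seq_space {1..<t} Z \<Otimes>\<^sub>M Z"
    by (rule measurable_Pair)
qed

text \<open>The integrand varies with \<open>h\<close> together with the measure. Pushing
  \<open>K h\<close> forward along \<open>Pair h\<close> moves all dependence on \<open>h\<close>
  into the measure and leaves the fixed integrand \<open>f\<close>, so measurability of integration
  against a kernel applies.\<close>

lemma measurable_integral_kernel:
  fixes f :: "_ \<Rightarrow> real"
  assumes K: "K \<in> H \<rightarrow>\<^sub>M prob_algebra Z" and f [measurable]: "f \<in> borel_measurable (H \<Otimes>\<^sub>M Z)"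
  shows "(\<lambda>h. \<integral>z. f (h, z) \<partial>K h) \<in> borel_measurable H"
proof -
  note [measurable] = measurable_prob_algebraD[OF K]
  note measurable_distr2[measurable]
  have "(\<lambda>h. integral\<^sup>L (distr (K h) (H \<Otimes>\<^sub>M Z) (Pair h)) f) \<in> borel_measurable H"
    by measurable
  then show ?thesis
  proof (rule measurable_cong[THEN iffD1, rotated])
    fix h assume "h \<in> space H"
    then have "Pair h \<in> K h \<rightarrow>\<^sub>M H \<Otimes>\<^sub>M Z"
      using sets_kernel[OF measurable_prob_algebraD[OF K]] by (simp cong: measurable_cong_sets)
    then show "integral\<^sup>L (distr (K h) (H \<Otimes>\<^sub>M Z) (Pair h)) f = (\<integral>z. f (h, z) \<partial>K h)"
      by (rule integral_distr) (rule f)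
  qed
qed

text \<open>Tower property, read off from the joint law as a bind. The nonnegative version serves
  the exponential moments, the bounded real version the expectation of the exponent under
  \<open>P\<close>.\<close>

lemma
  assumes P: "prob_space P" "sets P = sets (seq_space {1..T} Z)"
    and K: "disintegrates T Z P K" and t: "t \<in> {1..T}"
  shows nn_integral_hist: "\<And>f. f \<in> borel_measurable (seq_space {1..<t} Z \<Otimes>\<^sub>M Z) \<Longrightarrow>
      (\<integral>\<^sup>+\<omega>. f (hist \<omega> t, \<omega> t) \<partial>P) = (\<integral>\<^sup>+\<omega>. \<integral>\<^sup>+z. f (hist \<omega> t, z) \<partial>K t (hist \<omega> t) \<partial>P)"
    and integral_hist: "\<And>f c. f \<in> borel_measurable (seq_space {1..<t} Z \<Otimes>\<^sub>M Z) \<Longrightarrow>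
      (\<And>x. x \<in> space (seq_space {1..<t} Z \<Otimes>\<^sub>M Z) \<Longrightarrow> \<bar>f x\<bar> \<le> (c::real)) \<Longrightarrow>
      (\<integral>\<omega>. f (hist \<omega> t, \<omega> t) \<partial>P) = (\<integral>\<omega>. \<integral>z. f (hist \<omega> t, z) \<partial>K t (hist \<omega> t) \<partial>P)"
proof -
  interpret prob_space P by fact
  define H where "H = seq_space {1..<t} Z"
  have t': "{1..t} \<subseteq> {1..T}" "1 \<le> t" using t by auto
  note pair = measurable_hist_pair(1)[OF P(2) t', folded H_def]
    and hist = measurable_hist_pair(2)[OF P(2) t', folded H_def]
  note law = distr_hist_coordinate[OF P K t, folded H_def]
  note K' [measurable] = measurable_prob_algebraD[OF disintegratesD_measurable[OF K t], folded H_def]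
  define M where "M = distr P H (\<lambda>\<omega>. hist \<omega> t)"
  interpret M: prob_space M unfolding M_def by (rule prob_space_distr[OF hist])
  have [measurable_cong, simp]: "sets M = sets H" and spM: "space M = space H" by (simp_all add: M_def)
  define E where "E = (\<lambda>h. distr (K t h) (H \<Otimes>\<^sub>M Z) (Pair h))"
  have E: "E \<in> M \<rightarrow>\<^sub>M subprob_algebra (H \<Otimes>\<^sub>M Z)"
    unfolding E_def by (rule measurable_distr2[where M=Z]) measurable
  have P_h: "Pair h \<in> K t h \<rightarrow>\<^sub>M H \<Otimes>\<^sub>M Z" if "h \<in> space H" for h
    using that sets_kernel[OF K' that] by (simp cong: measurable_cong_sets)
  show "(\<integral>\<^sup>+\<omega>. f (hist \<omega> t, \<omega> t) \<partial>P) = (\<integral>\<^sup>+\<omega>. \<integral>\<^sup>+z. f (hist \<omega> t, z) \<partial>K t (hist \<omega> t) \<partial>P)"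
    if "f \<in> borel_measurable (seq_space {1..<t} Z \<Otimes>\<^sub>M Z)" for f
  proof -
    have f: "f \<in> borel_measurable (H \<Otimes>\<^sub>M Z)" using that by (simp only: H_def)
    have "(\<integral>\<^sup>+\<omega>. f (hist \<omega> t, \<omega> t) \<partial>P) = (\<integral>\<^sup>+x. f x \<partial>(M \<bind> E))"
      unfolding M_def E_def law[symmetric] by (rule nn_integral_distr[OF pair, symmetric]) (simp add: f)
    also have "\<dots> = (\<integral>\<^sup>+h. \<integral>\<^sup>+x. f x \<partial>E h \<partial>M)"
      by (rule nn_integral_bind[OF f E])
    also have "\<dots> = (\<integral>\<^sup>+h. \<integral>\<^sup>+z. f (h, z) \<partial>K t h \<partial>M)"
      unfolding E_def using P_h by (intro nn_integral_cong nn_integral_distr) (auto simp: spM f)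
    also have "\<dots> = (\<integral>\<^sup>+\<omega>. \<integral>\<^sup>+z. f (hist \<omega> t, z) \<partial>K t (hist \<omega> t) \<partial>P)"
      unfolding M_def
      by (rule nn_integral_distr[OF hist])
        (use f in \<open>simp add: nn_integral_measurable_subprob_algebra2[OF _ K']\<close>)
    finally show ?thesis .
  qed
  show "(\<integral>\<omega>. f (hist \<omega> t, \<omega> t) \<partial>P) = (\<integral>\<omega>. \<integral>z. f (hist \<omega> t, z) \<partial>K t (hist \<omega> t) \<partial>P)"
    if "f \<in> borel_measurable (seq_space {1..<t} Z \<Otimes>\<^sub>M Z)"
      and bnd: "\<And>x. x \<in> space (seq_space {1..<t} Z \<Otimes>\<^sub>M Z) \<Longrightarrow> \<bar>f x\<bar> \<le> (c::real)" for f c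
  proof -
    have f: "f \<in> borel_measurable (H \<Otimes>\<^sub>M Z)" using that(1) by (simp only: H_def)
    have "(\<integral>\<omega>. f (hist \<omega> t, \<omega> t) \<partial>P) = (\<integral>x. f x \<partial>(M \<bind> E))"
      unfolding M_def E_def law[symmetric] by (rule integral_distr[OF pair f, symmetric])
    also have "\<dots> = (\<integral>h. \<integral>x. f x \<partial>E h \<partial>M)"
    proof (rule integral_bind[OF f bnd[folded H_def] E M.finite_measure_axioms, where B'=1])
      show "AE h in M. emeasure (E h) (space (E h)) \<le> ennreal 1"
        using subprob_space.emeasure_space_le_1[OF subprob_space_kernel[OF E]] by simp
    qed
    also have "\<dots> = (\<integral>h. \<integral>z. f (h, z) \<partial>K t h \<partial>M)"
      unfolding E_def using P_h by (intro Bochner_Integration.integral_cong refl integral_distr f) (auto simp: spM)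
    also have "\<dots> = (\<integral>\<omega>. \<integral>z. f (hist \<omega> t, z) \<partial>K t (hist \<omega> t) \<partial>P)"
      unfolding M_def
      by (rule integral_distr[OF hist measurable_integral_kernel[OF disintegratesD_measurable[OF K t, folded H_def] f]])
    finally show ?thesis .
  qed
qed

lemma
  fixes f :: "'a \<times> 'b \<Rightarrow> real"
  assumes f: "f \<in> borel_measurable (H \<Otimes>\<^sub>M Z)"
    and bnd: "\<And>x. x \<in> space (H \<Otimes>\<^sub>M Z) \<Longrightarrow> \<bar>f x\<bar> \<le> c"
    and h: "h \<in> space H" and M: "prob_space M" "sets M = sets Z"
  shows integrable_section: "integrable M (\<lambda>z. f (h, z))"
    and abs_integral_section_le: "\<bar>\<integral>z. f (h, z) \<partial>M\<bar> \<le> c"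
proof -
  interpret M: prob_space M by fact
  have "(\<lambda>z. f (h, z)) \<in> borel_measurable M"
    unfolding measurable_cong_sets[OF M(2) refl] using measurable_compose[OF measurable_Pair1'[OF h] f] .
  moreover have *: "\<bar>f (h, z)\<bar> \<le> c" if "z \<in> space M" for z
    using that h sets_eq_imp_space_eq[OF M(2)] by (intro bnd) (auto simp: space_pair_measure)
  ultimately show I: "integrable M (\<lambda>z. f (h, z))"
    by (intro M.integrable_const_bound[where B=c]) (auto intro!: AE_I2)
  have "- c \<le> (\<integral>z. f (h, z) \<partial>M)"
    by (rule M.integral_ge_const[OF I]) (use * in \<open>auto simp: abs_le_iff intro!: AE_I2 dest!: minus_le_iff[THEN iffD1]\<close>)
  moreover have "(\<integral>z. f (h, z) \<partial>M) \<le> c"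
    by (rule M.integral_le_const[OF I]) (use * in \<open>auto simp: abs_le_iff intro!: AE_I2\<close>)
  ultimately show "\<bar>\<integral>z. f (h, z) \<partial>M\<bar> \<le> c" by (simp add: abs_le_iff)
qed

subsection \<open>Exponential supermartingales\<close>

text \<open>The range of \<open>f\<close> has length \<open>2 * L\<close>, so Hoeffding's lemma
  yields the exponent \<open>s\<^sup>2 * (2 * L)\<^sup>2 / 8 = s\<^sup>2 * L\<^sup>2 / 2\<close>.
  Moving it to the left makes the bound 1, ready to be multiplied over rounds. All signs of
  \<open>s\<close> are covered because the weights used later can be negative.\<close>

lemma hoeffding_mgf:
  assumes M: "prob_space M" and f [measurable]: "f \<in> borel_measurable M"
    and bnd: "\<And>x. x \<in> space M \<Longrightarrow> \<bar>f x\<bar> \<le> L"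
  shows "(\<integral>\<^sup>+x. ennreal (exp (s * (f x - (\<integral>y. f y \<partial>M)) - s\<^sup>2 * L\<^sup>2 / 2)) \<partial>M) \<le> 1"
proof -
  interpret prob_space M by fact
  \<comment> \<open>Stated for arbitrary \<open>g\<close> so that negative \<open>s\<close> reduces
    to a positive parameter with \<open>- f\<close>.\<close>
  have *: "(\<integral>\<^sup>+x. ennreal (exp (r * (g x - (\<integral>y. g y \<partial>M)) - r\<^sup>2 * L\<^sup>2 / 2)) \<partial>M) \<le> 1"
    if r: "0 < r" and [measurable]: "g \<in> borel_measurable M"
      and g: "\<And>x. x \<in> space M \<Longrightarrow> \<bar>g x\<bar> \<le> L" for r :: real and g
  proof -
    interpret interval_bounded_random_variable M g "- L" L
      using g by unfold_locales (auto simp: abs_le_iff intro!: AE_I2 dest!: minus_le_iff[THEN iffD1])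
    have "(\<integral>\<^sup>+x. ennreal (exp (r * (g x - (\<integral>y. g y \<partial>M)) - r\<^sup>2 * L\<^sup>2 / 2)) \<partial>M)
        = (\<integral>\<^sup>+x. ennreal (exp (- (r\<^sup>2 * L\<^sup>2 / 2))) * ennreal (exp (r * (g x - (\<integral>y. g y \<partial>M)))) \<partial>M)"
      by (simp add: exp_minus_inverse flip: ennreal_mult exp_add)
    also have "\<dots> = ennreal (exp (- (r\<^sup>2 * L\<^sup>2 / 2))) * (\<integral>\<^sup>+x. ennreal (exp (r * (g x - (\<integral>y. g y \<partial>M)))) \<partial>M)"
      by (rule nn_integral_cmult) measurable
    also have "\<dots> \<le> ennreal (exp (- (r\<^sup>2 * L\<^sup>2 / 2))) * ennreal (exp (r\<^sup>2 * (L - - L)\<^sup>2 / 8))"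
      by (intro mult_left_mono Hoeffdings_lemma_nn_integral r) auto
    also have "\<dots> = 1"
      by (simp add: power2_eq_square field_simps flip: ennreal_mult exp_add)
    finally show ?thesis .
  qed
  consider "s > 0" | "s = 0" | "s < 0" by linarith
  then show ?thesis
  proof cases
    case 3
    have "(\<integral>\<^sup>+x. ennreal (exp ((- s) * (- f x - (\<integral>y. - f y \<partial>M)) - (- s)\<^sup>2 * L\<^sup>2 / 2)) \<partial>M) \<le> 1"
      using 3 bnd by (intro *) auto
    then show ?thesis by (simp add: algebra_simps)
  qed (use *[OF _ f bnd] in \<open>auto simp: emeasure_space_1\<close>)
qed

lemma measurable_sum_hist:
  fixes F :: "nat \<Rightarrow> _ \<Rightarrow> real"
  assumes "sets M = sets (seq_space S Z)" "{1..n} \<subseteq> S"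
    and F: "\<And>t. t \<in> {1..n} \<Longrightarrow> F t \<in> borel_measurable (seq_space {1..<t} Z \<Otimes>\<^sub>M Z)"
  shows "(\<lambda>\<omega>. \<Sum>t=1..n. F t (hist \<omega> t, \<omega> t)) \<in> borel_measurable M"
proof (rule borel_measurable_sum)
  fix t assume t: "t \<in> {1..n}"
  then have "{1..t} \<subseteq> S" "1 \<le> t" using assms(2) by force+
  from measurable_compose[OF measurable_hist_pair(1)[OF assms(1) this] F[OF t]]
  show "(\<lambda>\<omega>. F t (hist \<omega> t, \<omega> t)) \<in> borel_measurable M" .
qed

text \<open>Supermartingale induction: given the history before the last round, the exponential of
  the earlier summands is a constant factor, and the remaining conditional expectation is at most
  1.\<close>

lemma nn_integral_exp_sum_le_1:
  fixes F :: "nat \<Rightarrow> (nat \<Rightarrow> 'z) \<times> 'z \<Rightarrow> real"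
  assumes P: "prob_space P" "sets P = sets (seq_space {1..T} Z)"
    and K: "disintegrates T Z P K"
    and F: "\<And>t. t \<in> {1..T} \<Longrightarrow> F t \<in> borel_measurable (seq_space {1..<t} Z \<Otimes>\<^sub>M Z)"
    and le_1: "\<And>t h. t \<in> {1..T} \<Longrightarrow> h \<in> space (seq_space {1..<t} Z) \<Longrightarrow>
      (\<integral>\<^sup>+z. ennreal (exp (F t (h, z))) \<partial>K t h) \<le> 1"
    and n: "n \<le> T"
  shows "(\<integral>\<^sup>+\<omega>. ennreal (exp (\<Sum>t=1..n. F t (hist \<omega> t, \<omega> t))) \<partial>P) \<le> 1"
  using n
proof (induction n)
  case 0
  then show ?case using prob_space.emeasure_space_1[OF P(1)] by simp
next
  case (Suc n)
  define U where "U = (\<lambda>\<omega>. \<Sum>t=1..n. F t (hist \<omega> t, \<omega> t))"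
  define H where "H = seq_space {1..<Suc n} Z"
  have Sn: "Suc n \<in> {1..T}" and "{1..Suc n} \<subseteq> {1..T}" "1 \<le> Suc n" using Suc.prems by auto
  then have hist: "(\<lambda>\<omega>. hist \<omega> (Suc n)) \<in> P \<rightarrow>\<^sub>M H"
    unfolding H_def by (intro measurable_hist_pair(2)[OF P(2)])
  have [measurable]: "F (Suc n) \<in> borel_measurable (H \<Otimes>\<^sub>M Z)"
    unfolding H_def by (rule F[OF Sn])
  have [measurable]: "U \<in> borel_measurable H"
    unfolding U_def H_def using Suc.prems by (intro measurable_sum_hist[OF refl] F) auto
  \<comment> \<open>The first \<open>n\<close> summands read only coordinates up to
    \<open>n\<close>, and these all survive in the history before round
    \<open>Suc n\<close>.\<close>
  have U: "U (hist \<omega> (Suc n)) = U \<omega>" for \<omega>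
    unfolding U_def
  proof (rule sum.cong[OF refl])
    fix t assume t: "t \<in> {1..n}"
    then have "{1..<t} \<subseteq> {1..<Suc n}" by auto
    then have "hist (hist \<omega> (Suc n)) t = hist \<omega> t" "hist \<omega> (Suc n) t = \<omega> t"
      using t by (auto simp: hist_def fun_eq_iff)
    then show "F t (hist (hist \<omega> (Suc n)) t, hist \<omega> (Suc n) t) = F t (hist \<omega> t, \<omega> t)" by simp
  qed
  have "(\<integral>\<^sup>+\<omega>. ennreal (exp (\<Sum>t=1..Suc n. F t (hist \<omega> t, \<omega> t))) \<partial>P) =
      (\<integral>\<^sup>+\<omega>. (\<lambda>(h, z). ennreal (exp (U h)) * ennreal (exp (F (Suc n) (h, z)))) (hist \<omega> (Suc n), \<omega> (Suc n)) \<partial>P)"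
    using U by (intro nn_integral_cong) (simp add: U_def exp_add ennreal_mult)
  also have "\<dots> = (\<integral>\<^sup>+\<omega>. \<integral>\<^sup>+z. ennreal (exp (U (hist \<omega> (Suc n)))) *
      ennreal (exp (F (Suc n) (hist \<omega> (Suc n), z))) \<partial>K (Suc n) (hist \<omega> (Suc n)) \<partial>P)"
    by (subst nn_integral_hist[OF P K Sn, folded H_def]) simp_all
  also have "\<dots> \<le> (\<integral>\<^sup>+\<omega>. ennreal (exp (U \<omega>)) \<partial>P)"
  proof (rule nn_integral_mono)
    fix \<omega> assume "\<omega> \<in> space P"
    then have h: "hist \<omega> (Suc n) \<in> space H" by (rule measurable_space[OF hist])
    have "(\<lambda>z. F (Suc n) (hist \<omega> (Suc n), z)) \<in> borel_measurable (K (Suc n) (hist \<omega> (Suc n)))"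
      unfolding measurable_cong_sets[OF disintegratesD_kernel(2)[OF K Sn h[unfolded H_def]] refl]
      using h by simp
    then have "(\<integral>\<^sup>+z. ennreal (exp (U (hist \<omega> (Suc n)))) *
        ennreal (exp (F (Suc n) (hist \<omega> (Suc n), z))) \<partial>K (Suc n) (hist \<omega> (Suc n))) =
      ennreal (exp (U \<omega>)) * (\<integral>\<^sup>+z. ennreal (exp (F (Suc n) (hist \<omega> (Suc n), z))) \<partial>K (Suc n) (hist \<omega> (Suc n)))"
      by (subst nn_integral_cmult) (simp_all add: U)
    also have "\<dots> \<le> ennreal (exp (U \<omega>)) * 1"
      using h by (intro mult_left_mono le_1[OF Sn]) (simp_all add: H_def)
    finally show "(\<integral>\<^sup>+z. ennreal (exp (U (hist \<omega> (Suc n)))) *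
        ennreal (exp (F (Suc n) (hist \<omega> (Suc n), z))) \<partial>K (Suc n) (hist \<omega> (Suc n))) \<le> ennreal (exp (U \<omega>))"
      by simp
  qed
  also have "\<dots> \<le> 1"
    using Suc.IH Suc.prems by (simp add: U_def)
  finally show ?case .
qed

text \<open>The weights are predictable: once the history is fixed, \<open>s t h\<close> is a number
  and \<open>hoeffding_mgf\<close> applies to each round separately.\<close>

lemma nn_integral_exp_centered_sum_le_1:
  fixes g :: "nat \<Rightarrow> (nat \<Rightarrow> 'z) \<times> 'z \<Rightarrow> real"
  assumes P: "prob_space P" "sets P = sets (seq_space {1..T} Z)"
    and K: "disintegrates T Z P K"
    and g: "\<And>t. t \<in> {1..T} \<Longrightarrow> g t \<in> borel_measurable (seq_space {1..<t} Z \<Otimes>\<^sub>M Z)"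
    and bnd: "\<And>t x. t \<in> {1..T} \<Longrightarrow> x \<in> space (seq_space {1..<t} Z \<Otimes>\<^sub>M Z) \<Longrightarrow> \<bar>g t x\<bar> \<le> L"
    and s: "\<And>t. t \<in> {1..T} \<Longrightarrow> s t \<in> borel_measurable (seq_space {1..<t} Z)"
  shows "(\<integral>\<^sup>+\<omega>. ennreal (exp (\<Sum>t=1..T.
      s t (hist \<omega> t) * (g t (hist \<omega> t, \<omega> t) - (\<integral>z. g t (hist \<omega> t, z) \<partial>K t (hist \<omega> t)))
      - (s t (hist \<omega> t))\<^sup>2 * L\<^sup>2 / 2)) \<partial>P) \<le> 1"
proof -
  define F where "F = (\<lambda>t x. s t (fst x) * (g t x - (\<integral>z. g t (fst x, z) \<partial>K t (fst x))) - (s t (fst x))\<^sup>2 * L\<^sup>2 / 2)"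
  have "(\<integral>\<^sup>+\<omega>. ennreal (exp (\<Sum>t=1..T. F t (hist \<omega> t, \<omega> t))) \<partial>P) \<le> 1"
  proof (rule nn_integral_exp_sum_le_1[OF P K _ _ order_refl])
    fix t assume t: "t \<in> {1..T}"
    note [measurable] = g[OF t] s[OF t] measurable_integral_kernel[OF disintegratesD_measurable[OF K t] g[OF t]]
    show "F t \<in> borel_measurable (seq_space {1..<t} Z \<Otimes>\<^sub>M Z)"
      unfolding F_def by measurable
    fix h assume h: "h \<in> space (seq_space {1..<t} Z)"
    note k = disintegratesD_kernel[OF K t h]
    show "(\<integral>\<^sup>+z. ennreal (exp (F t (h, z))) \<partial>K t h) \<le> 1"
      unfolding F_def fst_conv
    proof (rule hoeffding_mgf[OF k(1)])
      show "(\<lambda>z. g t (h, z)) \<in> borel_measurable (K t h)"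
        unfolding measurable_cong_sets[OF k(2) refl] using h by measurable
      show "\<bar>g t (h, z)\<bar> \<le> L" if "z \<in> space (K t h)" for z
        using that h k(3) by (intro bnd[OF t]) (auto simp: space_pair_measure)
    qed
  qed
  then show ?thesis by (simp add: F_def)
qed

text \<open>Centring by the means under \<open>KQ\<close> makes the exponential moment under
  \<open>Q\<close> at most 1. Under \<open>P\<close> the same exponent has conditional mean
  \<open>s * N - s\<^sup>2 * L\<^sup>2 / 2\<close> in each round, which is largest at
  \<open>s = N / L\<^sup>2\<close>, with value \<open>N\<^sup>2 / (2 * L\<^sup>2)\<close>.
  \<open>integral_le_kl_div\<close> compares the two.\<close>

lemma sum_kernel_gap_le_kl_div:
  fixes g :: "nat \<Rightarrow> (nat \<Rightarrow> 'z) \<times> 'z \<Rightarrow> real"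
  assumes P: "prob_space P" "sets P = sets (seq_space {1..T} Z)"
    and Q: "prob_space Q" "sets Q = sets (seq_space {1..T} Z)"
    and KP: "disintegrates T Z P KP" and KQ: "disintegrates T Z Q KQ"
    and g: "\<And>t. t \<in> {1..T} \<Longrightarrow> g t \<in> borel_measurable (seq_space {1..<t} Z \<Otimes>\<^sub>M Z)"
    and bnd: "\<And>t x. t \<in> {1..T} \<Longrightarrow> x \<in> space (seq_space {1..<t} Z \<Otimes>\<^sub>M Z) \<Longrightarrow> \<bar>g t x\<bar> \<le> L"
    and L: "0 < L"
  defines "N \<equiv> \<lambda>t h. (\<integral>z. g t (h, z) \<partial>KP t h) - (\<integral>z. g t (h, z) \<partial>KQ t h)"
  shows "ereal (\<Sum>t=1..T. (\<integral>\<omega>. (N t (hist \<omega> t))\<^sup>2 \<partial>P) / (2 * L\<^sup>2)) \<le> kl_div P Q"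
proof -
  interpret P: prob_space P by fact
  define m where "m = (\<lambda>t h. \<integral>z. g t (h, z) \<partial>KQ t h)"
  define s where "s = (\<lambda>t h. N t h / L\<^sup>2)"
  define F where "F = (\<lambda>t x. s t (fst x) * (g t x - m t (fst x)) - (s t (fst x))\<^sup>2 * L\<^sup>2 / 2)"
  define u where "u = (\<lambda>\<omega>. \<Sum>t=1..T. F t (hist \<omega> t, \<omega> t))"
  note kP = disintegratesD_kernel[OF KP] and kQ = disintegratesD_kernel[OF KQ]
  have s_meas: "s t \<in> borel_measurable (seq_space {1..<t} Z)"
    and m_meas: "m t \<in> borel_measurable (seq_space {1..<t} Z)" if t: "t \<in> {1..T}" for t
  proof -
    note [measurable] = measurable_integral_kernel[OF disintegratesD_measurable[OF KP t] g[OF t]]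
      measurable_integral_kernel[OF disintegratesD_measurable[OF KQ t] g[OF t]]
    show "s t \<in> borel_measurable (seq_space {1..<t} Z)"
      unfolding s_def N_def by measurable
    show "m t \<in> borel_measurable (seq_space {1..<t} Z)"
      unfolding m_def by measurable
  qed
  have F_meas: "F t \<in> borel_measurable (seq_space {1..<t} Z \<Otimes>\<^sub>M Z)" if t: "t \<in> {1..T}" for t
  proof -
    note [measurable] = s_meas[OF t] m_meas[OF t] g[OF t]
    show ?thesis unfolding F_def by measurable
  qed
  \<comment> \<open>Here \<open>\<bar>s\<bar> \<le> 2 / L\<close> and
    \<open>\<bar>g - m\<bar> \<le> 2 * L\<close>, so the linear term is at most 4 and the quadratic
    one at most 2.\<close>
  have F_bnd: "\<bar>F t x\<bar> \<le> 6" if t: "t \<in> {1..T}" and x: "x \<in> space (seq_space {1..<t} Z \<Otimes>\<^sub>M Z)" for t x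
  proof -
    have h: "fst x \<in> space (seq_space {1..<t} Z)" using x by (auto simp: space_pair_measure)
    note a = abs_integral_section_le[OF g[OF t] bnd[OF t] h kP(1,2)[OF t h]] and b = abs_integral_section_le[OF g[OF t] bnd[OF t] h kQ(1,2)[OF t h]]
    have "\<bar>N t (fst x)\<bar> \<le> 2 * L" using a b unfolding N_def by linarith
    then have s: "\<bar>s t (fst x)\<bar> \<le> 2 / L"
      using L by (simp add: s_def field_simps power2_eq_square)
    have "\<bar>g t x - m t (fst x)\<bar> \<le> 2 * L" using bnd[OF t x] b unfolding m_def by linarith
    then have "\<bar>s t (fst x) * (g t x - m t (fst x))\<bar> \<le> (2 / L) * (2 * L)"
      unfolding abs_mult using s L by (intro mult_mono) auto
    also have "(2 / L) * (2 * L) = 4" using L by simp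
    finally have A: "\<bar>s t (fst x) * (g t x - m t (fst x))\<bar> \<le> 4" .
    have "\<bar>s t (fst x) * L\<bar> \<le> 2" using s L by (simp add: abs_mult field_simps)
    then have "(s t (fst x) * L)\<^sup>2 \<le> 2\<^sup>2" by (subst abs_le_square_iff[symmetric]) simp
    then have B: "(s t (fst x))\<^sup>2 * L\<^sup>2 \<le> 4" by (simp add: power_mult_distrib)
    have C: "0 \<le> (s t (fst x))\<^sup>2 * L\<^sup>2" by simp
    show ?thesis unfolding F_def using A B C by linarith
  qed
  have pair: "(\<lambda>\<omega>. (hist \<omega> t, \<omega> t)) \<in> P \<rightarrow>\<^sub>M seq_space {1..<t} Z \<Otimes>\<^sub>M Z"
    "(\<lambda>\<omega>. hist \<omega> t) \<in> P \<rightarrow>\<^sub>M seq_space {1..<t} Z"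
    if t: "t \<in> {1..T}" for t
    using t by (intro measurable_hist_pair[OF P(2)]; simp)+
  have int_F: "integrable P (\<lambda>\<omega>. F t (hist \<omega> t, \<omega> t))" if t: "t \<in> {1..T}" for t
    using measurable_compose[OF pair(1)[OF t] F_meas[OF t]] F_bnd[OF t measurable_space[OF pair(1)[OF t]]]
    by (intro P.integrable_const_bound[where B=6]) (auto intro!: AE_I2)
  have "(\<integral>\<omega>. u \<omega> \<partial>P) = (\<Sum>t=1..T. \<integral>\<omega>. F t (hist \<omega> t, \<omega> t) \<partial>P)"
    unfolding u_def by (rule Bochner_Integration.integral_sum) (rule int_F)
  also have "\<dots> = (\<Sum>t=1..T. (\<integral>\<omega>. (N t (hist \<omega> t))\<^sup>2 \<partial>P) / (2 * L\<^sup>2))"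
  proof (rule sum.cong[OF refl])
    fix t assume t: "t \<in> {1..T}"
    have "(\<integral>\<omega>. F t (hist \<omega> t, \<omega> t) \<partial>P) = (\<integral>\<omega>. \<integral>z. F t (hist \<omega> t, z) \<partial>KP t (hist \<omega> t) \<partial>P)"
      by (rule integral_hist[OF P KP t F_meas[OF t] F_bnd[OF t]])
    also have "\<dots> = (\<integral>\<omega>. (N t (hist \<omega> t))\<^sup>2 / (2 * L\<^sup>2) \<partial>P)"
    proof (rule Bochner_Integration.integral_cong[OF refl])
      fix \<omega> assume "\<omega> \<in> space P"
      then have h: "hist \<omega> t \<in> space (seq_space {1..<t} Z)" (is "?h \<in> _")
        by (rule measurable_space[OF pair(2)[OF t]])
      interpret M: prob_space "KP t ?h" by (rule kP(1)[OF t h])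
      note I = integrable_section[OF g[OF t] bnd[OF t] h kP(1,2)[OF t h]]
      have "(\<integral>z. F t (?h, z) \<partial>KP t ?h) = s t ?h * ((\<integral>z. g t (?h, z) \<partial>KP t ?h) - m t ?h) - (s t ?h)\<^sup>2 * L\<^sup>2 / 2"
        unfolding F_def fst_conv using I by (simp add: M.prob_space)
      also have "\<dots> = (N t ?h)\<^sup>2 / (2 * L\<^sup>2)"
        using L by (simp add: s_def N_def m_def field_simps power2_eq_square)
      finally show "(\<integral>z. F t (?h, z) \<partial>KP t ?h) = (N t ?h)\<^sup>2 / (2 * L\<^sup>2)" .
    qed
    finally show "(\<integral>\<omega>. F t (hist \<omega> t, \<omega> t) \<partial>P) = (\<integral>\<omega>. (N t (hist \<omega> t))\<^sup>2 \<partial>P) / (2 * L\<^sup>2)"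
      by simp
  qed
  finally have *: "(\<integral>\<omega>. u \<omega> \<partial>P) = \<dots>" .
  have setsPQ: "sets P = sets Q" using P(2) Q(2) by simp
  have "ereal (\<integral>\<omega>. u \<omega> \<partial>P) \<le> kl_div P Q"
  proof (rule integral_le_kl_div[OF P(1) Q(1) setsPQ])
    show "u \<in> borel_measurable Q"
      unfolding u_def by (rule measurable_sum_hist[OF Q(2) order_refl]) (rule F_meas)
    show "\<bar>u \<omega>\<bar> \<le> real T * 6" if "\<omega> \<in> space Q" for \<omega>
    proof -
      have "\<bar>u \<omega>\<bar> \<le> (\<Sum>t=1..T. \<bar>F t (hist \<omega> t, \<omega> t)\<bar>)"
        unfolding u_def by (rule sum_abs)
      also have "\<dots> \<le> (\<Sum>t=1..T. 6)"
        using that sets_eq_imp_space_eq[OF setsPQ]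
        by (intro sum_mono F_bnd measurable_space[OF pair(1)]) auto
      finally show ?thesis by simp
    qed
    show "(\<integral>\<^sup>+\<omega>. ennreal (exp (u \<omega>)) \<partial>Q) \<le> 1"
      unfolding u_def F_def m_def fst_conv
      by (rule nn_integral_exp_centered_sum_le_1[OF Q KQ g bnd s_meas])
  qed
  then show ?thesis unfolding * .
qed

text \<open>Chernoff's bound combined with the exponential supermartingale for a constant
  weight.\<close>

lemma azuma_hoeffding_kernel:
  fixes g :: "nat \<Rightarrow> (nat \<Rightarrow> 'z) \<times> 'z \<Rightarrow> real"
  assumes P: "prob_space P" "sets P = sets (seq_space {1..T} Z)"
    and K: "disintegrates T Z P K"
    and g: "\<And>t. t \<in> {1..T} \<Longrightarrow> g t \<in> borel_measurable (seq_space {1..<t} Z \<Otimes>\<^sub>M Z)"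
    and bnd: "\<And>t x. t \<in> {1..T} \<Longrightarrow> x \<in> space (seq_space {1..<t} Z \<Otimes>\<^sub>M Z) \<Longrightarrow> \<bar>g t x\<bar> \<le> L"
    and L: "0 < L" and T: "1 \<le> T" and a: "0 < a"
  defines "D \<equiv> \<lambda>\<omega>. \<Sum>t=1..T. g t (hist \<omega> t, \<omega> t) - (\<integral>z. g t (hist \<omega> t, z) \<partial>K t (hist \<omega> t))"
  shows "D \<in> borel_measurable P"
    and "measure P {\<omega> \<in> space P. a \<le> D \<omega>} \<le> exp (- a\<^sup>2 / (2 * real T * L\<^sup>2))"
proof -
  interpret prob_space P by fact
  show D [measurable]: "D \<in> borel_measurable P"
    unfolding D_def
  proof (rule measurable_sum_hist[OF P(2) order_refl, where F="\<lambda>t x. g t x - (\<integral>z. g t (fst x, z) \<partial>K t (fst x))", unfolded fst_conv])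
    fix t assume t: "t \<in> {1..T}"
    note [measurable] = g[OF t] measurable_integral_kernel[OF disintegratesD_measurable[OF K t] g[OF t]]
    show "(\<lambda>x. g t x - (\<integral>z. g t (fst x, z) \<partial>K t (fst x))) \<in> borel_measurable (seq_space {1..<t} Z \<Otimes>\<^sub>M Z)"
      by measurable
  qed
  \<comment> \<open>This \<open>s\<close> minimises the exponent
    \<open>- s * a + real T * s\<^sup>2 * L\<^sup>2 / 2\<close>.\<close>
  define s where "s = a / (real T * L\<^sup>2)"
  have s: "0 < s" using a L T by (simp add: s_def)
  have "ennreal (measure P {\<omega> \<in> space P. a \<le> D \<omega>}) \<le>
      ennreal (exp (- s * a)) * (\<integral>\<^sup>+\<omega>. ennreal (exp (s * D \<omega>)) * indicator (space P) \<omega> \<partial>P)"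
    using Chernoff_ineq_nn_integral_ge[OF s sets.top, of D P a] by (simp add: emeasure_eq_measure)
  also have "(\<integral>\<^sup>+\<omega>. ennreal (exp (s * D \<omega>)) * indicator (space P) \<omega> \<partial>P) =
      (\<integral>\<^sup>+\<omega>. ennreal (exp (real T * s\<^sup>2 * L\<^sup>2 / 2)) * ennreal (exp (s * D \<omega> - real T * s\<^sup>2 * L\<^sup>2 / 2)) \<partial>P)"
    by (intro nn_integral_cong) (simp flip: ennreal_mult exp_add)
  also have "\<dots> = ennreal (exp (real T * s\<^sup>2 * L\<^sup>2 / 2)) * (\<integral>\<^sup>+\<omega>. ennreal (exp (s * D \<omega> - real T * s\<^sup>2 * L\<^sup>2 / 2)) \<partial>P)"
    by (rule nn_integral_cmult) measurable
  also have "(\<integral>\<^sup>+\<omega>. ennreal (exp (s * D \<omega> - real T * s\<^sup>2 * L\<^sup>2 / 2)) \<partial>P) \<le> 1"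
    using nn_integral_exp_centered_sum_le_1[OF P K g bnd, of "\<lambda>_ _. s"]
    by (simp add: D_def sum_distrib_left sum_subtractf right_diff_distrib mult.assoc)
  finally have "ennreal (measure P {\<omega> \<in> space P. a \<le> D \<omega>}) \<le>
      ennreal (exp (- s * a)) * (ennreal (exp (real T * s\<^sup>2 * L\<^sup>2 / 2)) * 1)"
    by (simp add: mult_left_mono)
  also have "\<dots> = ennreal (exp (- s * a + real T * s\<^sup>2 * L\<^sup>2 / 2))"
    by (simp flip: ennreal_mult exp_add)
  also have "- s * a + real T * s\<^sup>2 * L\<^sup>2 / 2 = - a\<^sup>2 / (2 * real T * L\<^sup>2)"
    using T L by (simp add: s_def field_simps power2_eq_square)
  finally show "measure P {\<omega> \<in> space P. a \<le> D \<omega>} \<le> exp (- a\<^sup>2 / (2 * real T * L\<^sup>2))"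
    by (simp add: ennreal_le_iff)
qed

subsection \<open>Regret bounds\<close>

text \<open>Markov's inequality for a strict event and without division by \<open>y\<close>, so that
  it survives a zero threshold, as happens when the kernel distance or the divergence is
  zero.\<close>

lemma (in prob_space) prob_gt_le_of_expectation_le:
  fixes W :: "'a \<Rightarrow> real"
  assumes W: "integrable M W" and nonneg: "\<And>x. x \<in> space M \<Longrightarrow> 0 \<le> W x"
    and p: "0 < p" and le: "expectation W \<le> y * p"
  shows "prob {x \<in> space M. y < W x} \<le> p"
proof -
  have [measurable]: "W \<in> borel_measurable M" using W by auto
  have E0: "0 \<le> expectation W" using nonneg by (rule Bochner_Integration.integral_nonneg)
  then have "0 \<le> y * p" using le by linarith
  then have "0 \<le> y" using p by (simp add: zero_le_mult_iff)
  then consider "0 < y" | "y = 0" by linarith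
  then show ?thesis
  proof cases
    case 1
    have "prob {x \<in> space M. y < W x} \<le> prob {x \<in> space M. y \<le> W x}"
      by (rule finite_measure_mono) auto
    also have "\<dots> \<le> expectation W / y"
      using integral_Markov_inequality_measure[OF W sets.empty_sets _ 1] nonneg by simp
    also have "\<dots> \<le> p" using le 1 by (simp add: field_simps)
    finally show ?thesis .
  next
    \<comment> \<open>A zero threshold forces \<open>W\<close> to have expectation zero, hence to
      vanish almost everywhere, and the strict event is null.\<close>
    case 2
    then have "expectation W = 0" using le E0 by simp
    then have "AE x in M. W x = 0"
      using W nonneg by (subst (asm) integral_nonneg_eq_0_iff_AE) auto
    then have "prob {x \<in> space M. y < W x} = prob {}"
      using 2 by (intro finite_measure_eq_AE) (auto elim!: eventually_mono)
    then show ?thesis using p by simp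
  qed
qed

text \<open>If \<open>R x \<ge> y + e\<close>, then \<open>e \<le> S x\<close> or
  \<open>y < Y x\<close>. Taking the first event non-strict is what gives a strict inequality in the
  conclusion.\<close>

lemma (in prob_space) prob_sum_less_ge:
  fixes R S Y :: "'a \<Rightarrow> real"
  assumes [measurable]: "R \<in> borel_measurable M" "S \<in> borel_measurable M" "Y \<in> borel_measurable M"
    and le: "\<And>x. x \<in> space M \<Longrightarrow> R x \<le> S x + Y x"
    and S: "prob {x \<in> space M. e \<le> S x} \<le> p" and Y: "prob {x \<in> space M. y < Y x} \<le> q"
  shows "1 - (p + q) \<le> prob {x \<in> space M. R x < y + e}"
proof -
  have "1 - prob {x \<in> space M. R x < y + e} = prob (space M - {x \<in> space M. R x < y + e})"
    by (rule prob_compl[symmetric]) measurable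
  also have "\<dots> \<le> prob ({x \<in> space M. e \<le> S x} \<union> {x \<in> space M. y < Y x})"
    by (rule finite_measure_mono) (use le in force)+
  also have "\<dots> \<le> prob {x \<in> space M. e \<le> S x} + prob {x \<in> space M. y < Y x}"
    by (rule measure_Un_le) measurable
  finally show ?thesis using S Y by linarith
qed

text \<open>Positivity of \<open>L\<close> matters for strictness: for \<open>L = 0\<close> both
  sides of either inequality would be zero, also with infinite divergence, since zero times infinity
  is zero in \<open>ereal\<close>.\<close>

theorem theorem4:
  fixes T :: nat and L :: real
    and Z :: "'z measure" and B :: "'b measure"
    and l :: "'b \<Rightarrow> 'z \<Rightarrow> real"
    and P Q :: "(nat \<Rightarrow> 'z) measure"
    and KP KQ :: "nat \<Rightarrow> (nat \<Rightarrow> 'z) \<Rightarrow> 'z measure"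
    and b bstar :: "nat \<Rightarrow> (nat \<Rightarrow> 'z) \<Rightarrow> 'b"
    and \<delta> :: real
  assumes "1 \<le> T" and "0 < L"
    and "(\<lambda>(a, z). l a z) \<in> borel_measurable (B \<Otimes>\<^sub>M Z)"
    and "\<And>a z. a \<in> space B \<Longrightarrow> z \<in> space Z \<Longrightarrow> l a z \<in> {0..L}"
    and "prob_space P" and "sets P = sets (seq_space {1..T} Z)"
    and "prob_space Q" and "sets Q = sets (seq_space {1..T} Z)"
    and "disintegrates T Z P KP" and "disintegrates T Z Q KQ"
    and "measurable_policy T Z B bstar" and "optimal_policy T Z B l KP bstar"
    and "measurable_policy T Z B b" and "optimal_policy T Z B l KQ b"
    and "\<And>t. t \<in> {1..T} \<Longrightarrow> kernel_dist KP KQ t \<in> borel_measurable P"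
    and "0 < \<delta>" and "\<delta> \<le> 1"
  shows "measure P {\<omega> \<in> space P. avg_regret T l b bstar \<omega> <
            4 * L * expected_kernel_dist T P KP KQ * (1 / \<delta>)
            + 2 * sqrt 2 * L / sqrt (real T) * sqrt (ln (2 / \<delta>))} \<ge> 1 - \<delta>
    \<and> measure P {\<omega> \<in> space P. ereal (avg_regret T l b bstar \<omega>) <
            ereal (2 * L) * ereal_sqrt (kl_div P Q / ereal (real T)) * ereal (1 / sqrt \<delta>)
            + ereal (2 * sqrt 2 * L / sqrt (real T) * sqrt (ln (2 / \<delta>)))} \<ge> 1 - \<delta>"
proof
  interpret P: prob_space P by fact
  note T = assms(1) and L = assms(2) and l_meas [measurable] = assms(3) and l_bnd = assms(4)
    and P = assms(5,6) and Q = assms(7,8) and KP = assms(9) and KQ = assms(10)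
    and opt = assms(14) and v_meas = assms(15) and \<delta> = assms(16,17)

  \<comment> \<open>Regret increments, kernel gaps and the common tail bound\<close>
  define g where "g = (\<lambda>t x. l (b t (fst x)) (snd x) - l (bstar t (fst x)) (snd x))"
  have b: "b t \<in> seq_space {1..<t} Z \<rightarrow>\<^sub>M B" "bstar t \<in> seq_space {1..<t} Z \<rightarrow>\<^sub>M B" if "t \<in> {1..T}" for t
    using that assms(11,13) by (auto simp: measurable_policy_def)
  have g: "g t \<in> borel_measurable (seq_space {1..<t} Z \<Otimes>\<^sub>M Z)" if t: "t \<in> {1..T}" for t
  proof -
    note [measurable] = b[OF t]
    have "(\<lambda>x. case (b t (fst x), snd x) of (a, z) \<Rightarrow> l a z) \<in> borel_measurable (seq_space {1..<t} Z \<Otimes>\<^sub>M Z)"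
      "(\<lambda>x. case (bstar t (fst x), snd x) of (a, z) \<Rightarrow> l a z) \<in> borel_measurable (seq_space {1..<t} Z \<Otimes>\<^sub>M Z)"
      by measurable
    then show ?thesis unfolding g_def by simp
  qed
  have l_in: "l (b t h) z \<in> {0..L}" "l (bstar t h) z \<in> {0..L}"
    if t: "t \<in> {1..T}" and h: "h \<in> space (seq_space {1..<t} Z)" and z: "z \<in> space Z" for t h z
    using l_bnd[OF measurable_space[OF b(1)[OF t] h] z] l_bnd[OF measurable_space[OF b(2)[OF t] h] z] by simp_all
  have g_bnd: "\<bar>g t x\<bar> \<le> L" if t: "t \<in> {1..T}" and x: "x \<in> space (seq_space {1..<t} Z \<Otimes>\<^sub>M Z)" for t x
    using l_in[OF t, of "fst x" "snd x"] x by (auto simp: g_def space_pair_measure abs_le_iff)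
  note kP = disintegratesD_kernel[OF KP] and kQ = disintegratesD_kernel[OF KQ]
  define M where "M = (\<lambda>t h. \<integral>z. g t (h, z) \<partial>KP t h)"
  define N where "N = (\<lambda>t h. (\<integral>z. g t (h, z) \<partial>KP t h) - (\<integral>z. g t (h, z) \<partial>KQ t h))"
  have l_int: "integrable K (\<lambda>z. l a z)"
    if a: "a \<in> space B" and K: "prob_space K" "sets K = sets Z" for K a
  proof -
    interpret K: prob_space K by fact
    have "(\<lambda>z. l a z) \<in> borel_measurable K"
      unfolding measurable_cong_sets[OF K(2) refl] using measurable_compose[OF measurable_Pair1'[OF a] l_meas] by simp
    then show ?thesis
      using l_bnd[OF a] sets_eq_imp_space_eq[OF K(2)]
      by (intro K.integrable_const_bound[where B=L]) (auto intro!: AE_I2)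
  qed
  \<comment> \<open>\<open>Q\<close>-optimality makes the mean of \<open>g\<close> under
    \<open>KQ\<close> nonpositive, so subtracting it can only increase the mean under
    \<open>KP\<close>.\<close>
  have M_le_N: "M t h \<le> N t h" if t: "t \<in> {1..T}" and h: "h \<in> space (seq_space {1..<t} Z)" for t h
  proof -
    note bh = measurable_space[OF b(1)[OF t] h] measurable_space[OF b(2)[OF t] h]
    have "(\<integral>z. l (b t h) z \<partial>KQ t h) \<le> (\<integral>z. l (bstar t h) z \<partial>KQ t h)"
      using opt t h bh unfolding optimal_policy_def is_arg_min_def by (meson not_less)
    then have "(\<integral>z. g t (h, z) \<partial>KQ t h) \<le> 0"
      using l_int[OF bh(1) kQ(1,2)[OF t h]] l_int[OF bh(2) kQ(1,2)[OF t h]] by (simp add: g_def)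
    then show ?thesis by (simp add: M_def N_def)
  qed
  have N_le: "N t h \<le> 2 * L * tv_dist (KP t h) (KQ t h)" if t: "t \<in> {1..T}" and h: "h \<in> space (seq_space {1..<t} Z)" for t h
  proof -
    interpret KP: prob_space "KP t h" by (rule kP(1)[OF t h])
    interpret KQ: prob_space "KQ t h" by (rule kQ(1)[OF t h])
    have int: "integrable (KP t h) (\<lambda>z. g t (h, z))" "integrable (KQ t h) (\<lambda>z. g t (h, z))"
      by (rule integrable_section[OF g[OF t] g_bnd[OF t] h]; use kP(1,2)[OF t h] kQ(1,2)[OF t h] in simp)+
    \<comment> \<open>Shifting by \<open>L\<close> moves the range into \<open>{0..2 * L}\<close>;
      the shift cancels because both kernels have mass 1.\<close>
    have "(\<integral>z. g t (h, z) + L \<partial>KP t h) - (\<integral>z. g t (h, z) + L \<partial>KQ t h) \<le> 2 * L * tv_dist (KP t h) (KQ t h)"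
    proof (rule integral_diff_le_tv_dist)
      show "sets (KQ t h) = sets (KP t h)" using kP(2)[OF t h] kQ(2)[OF t h] by simp
      show "(\<lambda>z. g t (h, z) + L) \<in> borel_measurable (KP t h)" using int(1) by simp
      show "0 \<le> g t (h, z) + L \<and> g t (h, z) + L \<le> 2 * L" if "z \<in> space (KP t h)" for z
        using g_bnd[OF t, of "(h, z)"] that h kP(3)[OF t h] by (simp add: space_pair_measure abs_le_iff)
    qed unfold_locales
    then show ?thesis
      unfolding N_def using int by (simp add: KP.prob_space KQ.prob_space)
  qed
  have hist: "(\<lambda>\<omega>. hist \<omega> t) \<in> P \<rightarrow>\<^sub>M seq_space {1..<t} Z" if "t \<in> {1..T}" for t
    using that by (intro measurable_hist_pair(2)[OF P(2)]) auto
  note hist_space = measurable_space[OF hist]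
  have N_meas: "(\<lambda>\<omega>. N t (hist \<omega> t)) \<in> borel_measurable P" if t: "t \<in> {1..T}" for t
  proof -
    note [measurable] = measurable_integral_kernel[OF disintegratesD_measurable[OF KP t] g[OF t]]
      measurable_integral_kernel[OF disintegratesD_measurable[OF KQ t] g[OF t]]
    have "N t \<in> borel_measurable (seq_space {1..<t} Z)" unfolding N_def by measurable
    then show ?thesis by (rule measurable_compose[OF hist[OF t]])
  qed
  have N_bnd: "\<bar>N t h\<bar> \<le> 2 * L" if t: "t \<in> {1..T}" and h: "h \<in> space (seq_space {1..<t} Z)" for t h
    using abs_integral_section_le[OF g[OF t] g_bnd[OF t] h kP(1,2)[OF t h]]
      abs_integral_section_le[OF g[OF t] g_bnd[OF t] h kQ(1,2)[OF t h]]
    unfolding N_def by linarith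
  define R where "R = avg_regret T l b bstar"
  define D where "D = (\<lambda>\<omega>. \<Sum>t=1..T. g t (hist \<omega> t, \<omega> t) - (\<integral>z. g t (hist \<omega> t, z) \<partial>KP t (hist \<omega> t)))"
  have R_eq: "R \<omega> = (1 / real T) * (\<Sum>t=1..T. g t (hist \<omega> t, \<omega> t))" for \<omega>
    by (simp add: R_def avg_regret_def g_def)
  have R_meas: "R \<in> borel_measurable P"
    unfolding R_eq[abs_def] using measurable_sum_hist[OF P(2) order_refl g] by simp
  define \<epsilon> where "\<epsilon> = 2 * sqrt 2 * L / sqrt (real T) * sqrt (ln (2 / \<delta>))"
  have ln2: "0 < ln (2 / \<delta>)" using \<delta> by (intro ln_gt_zero) (simp add: field_simps)
  then have \<epsilon>: "0 < \<epsilon>" using L T by (simp add: \<epsilon>_def)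
  have D_meas: "D \<in> borel_measurable P" and D_tail: "P.prob {\<omega> \<in> space P. \<epsilon> \<le> D \<omega> / real T} \<le> \<delta> / 2"
  proof -
    note azuma = azuma_hoeffding_kernel[OF P KP g g_bnd L T, of "real T * \<epsilon>"]
    show "D \<in> borel_measurable P" using azuma(1) T \<epsilon> by (simp add: D_def)
    have "P.prob {\<omega> \<in> space P. \<epsilon> \<le> D \<omega> / real T} \<le> exp (- (real T * \<epsilon>)\<^sup>2 / (2 * real T * L\<^sup>2))"
      using azuma(2) T \<epsilon> by (simp add: D_def field_simps)
    \<comment> \<open>The choice of \<open>\<epsilon>\<close> in fact gives the tail
      \<open>(\<delta> / 2) ^ 4\<close>; only the weaker \<open>\<delta> / 2\<close> is
      retained.\<close>
    also have "- (real T * \<epsilon>)\<^sup>2 / (2 * real T * L\<^sup>2) = - 4 * ln (2 / \<delta>)"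
      using T L ln2 by (simp add: \<epsilon>_def power_mult_distrib power_divide field_simps power2_eq_square)
    also have "exp (- 4 * ln (2 / \<delta>)) \<le> exp (- ln (2 / \<delta>))"
      using ln2 by simp
    also have "\<dots> = \<delta> / 2" using \<delta> by (simp add: exp_minus)
    finally show "P.prob {\<omega> \<in> space P. \<epsilon> \<le> D \<omega> / real T} \<le> \<delta> / 2" .
  qed
  \<comment> \<open>The failure probability is split evenly: half for the centred regret, half for a
    majorant \<open>Y\<close> of the average kernel gap. Both inequalities of the theorem are
    instances.\<close>
  have tail: "1 - \<delta> \<le> P.prob {\<omega> \<in> space P. R \<omega> < y + \<epsilon>}"
    if Y: "Y \<in> borel_measurable P" "P.prob {\<omega> \<in> space P. y < Y \<omega>} \<le> \<delta> / 2"
      and le: "\<And>\<omega>. \<omega> \<in> space P \<Longrightarrow> (\<Sum>t=1..T. N t (hist \<omega> t)) / real T \<le> Y \<omega>" for Y y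
  proof -
    have "1 - (\<delta> / 2 + \<delta> / 2) \<le> P.prob {\<omega> \<in> space P. R \<omega> < y + \<epsilon>}"
    proof (rule P.prob_sum_less_ge[OF R_meas _ Y(1) _ D_tail Y(2)])
      show "(\<lambda>\<omega>. D \<omega> / real T) \<in> borel_measurable P" using D_meas by simp
      fix \<omega> assume \<omega>: "\<omega> \<in> space P"
      have "(\<Sum>t=1..T. M t (hist \<omega> t)) \<le> (\<Sum>t=1..T. N t (hist \<omega> t))"
        using \<omega> by (intro sum_mono M_le_N hist_space)
      then have "R \<omega> \<le> D \<omega> / real T + (\<Sum>t=1..T. N t (hist \<omega> t)) / real T"
        using T by (simp add: R_eq D_def M_def sum_subtractf field_simps)
      then show "R \<omega> \<le> D \<omega> / real T + Y \<omega>" using le[OF \<omega>] by linarith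
    qed
    then show ?thesis by simp
  qed

  \<comment> \<open>First inequality: Markov for the average kernel distance\<close>
  define v where "v = (\<lambda>\<omega>. (1 / real T) * (\<Sum>t = 1..T. kernel_dist KP KQ t \<omega>))"
  have v_bnd: "0 \<le> kernel_dist KP KQ t \<omega>" "kernel_dist KP KQ t \<omega> \<le> 1"
    if t: "t \<in> {1..T}" and \<omega>: "\<omega> \<in> space P" for t \<omega>
    unfolding kernel_dist_def
    using kP(1)[OF t hist_space[OF t \<omega>]] kQ(1)[OF t hist_space[OF t \<omega>]]
    by (simp_all add: tv_dist_nonneg tv_dist_le_1)
  have v_int: "integrable P v"
    unfolding v_def using v_bnd v_meas
    by (intro integrable_mult_right Bochner_Integration.integrable_sum P.integrable_const_bound[where B=1])
      (auto intro!: AE_I2)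
  have "1 - \<delta> \<le> P.prob {\<omega> \<in> space P. R \<omega> < 4 * L * expected_kernel_dist T P KP KQ * (1 / \<delta>) + \<epsilon>}"
  proof (rule tail[of "\<lambda>\<omega>. 2 * L * v \<omega>"])
    show "P.prob {\<omega> \<in> space P. 4 * L * expected_kernel_dist T P KP KQ * (1 / \<delta>) < 2 * L * v \<omega>} \<le> \<delta> / 2"
    proof (rule P.prob_gt_le_of_expectation_le)
      \<comment> \<open>The expectation is \<open>2 * L\<close> times the expected kernel distance;
        Markov at level \<open>\<delta> / 2\<close> doubles this constant to 4.\<close>
      show "P.expectation (\<lambda>\<omega>. 2 * L * v \<omega>) \<le> 4 * L * expected_kernel_dist T P KP KQ * (1 / \<delta>) * (\<delta> / 2)"
        using \<delta> by (simp add: expected_kernel_dist_def v_def)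
      show "0 \<le> 2 * L * v \<omega>" if "\<omega> \<in> space P" for \<omega>
        using L v_bnd that unfolding v_def by (intro mult_nonneg_nonneg sum_nonneg) auto
    qed (use v_int \<delta> in auto)
    fix \<omega> assume \<omega>: "\<omega> \<in> space P"
    have "(\<Sum>t=1..T. N t (hist \<omega> t)) \<le> (\<Sum>t=1..T. 2 * L * kernel_dist KP KQ t \<omega>)"
      unfolding kernel_dist_def using \<omega> by (intro sum_mono N_le hist_space)
    then show "(\<Sum>t=1..T. N t (hist \<omega> t)) / real T \<le> 2 * L * v \<omega>"
      using T by (simp add: v_def sum_distrib_left[symmetric] field_simps)
  qed (use v_int in auto)
  then show "measure P {\<omega> \<in> space P. avg_regret T l b bstar \<omega> <
            4 * L * expected_kernel_dist T P KP KQ * (1 / \<delta>)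
            + 2 * sqrt 2 * L / sqrt (real T) * sqrt (ln (2 / \<delta>))} \<ge> 1 - \<delta>"
    by (simp only: R_def \<epsilon>_def)

  \<comment> \<open>Second inequality: Markov for the mean square of the kernel gaps\<close>
  have kl: "ereal (\<Sum>t=1..T. (\<integral>\<omega>. (N t (hist \<omega> t))\<^sup>2 \<partial>P) / (2 * L\<^sup>2)) \<le> kl_div P Q"
    unfolding N_def by (rule sum_kernel_gap_le_kl_div[OF P Q KP KQ g g_bnd L])
  show "measure P {\<omega> \<in> space P. ereal (avg_regret T l b bstar \<omega>) <
            ereal (2 * L) * ereal_sqrt (kl_div P Q / ereal (real T)) * ereal (1 / sqrt \<delta>)
            + ereal (2 * sqrt 2 * L / sqrt (real T) * sqrt (ln (2 / \<delta>)))} \<ge> 1 - \<delta>"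
  proof (cases "kl_div P Q")
    case PInf
    \<comment> \<open>The other factors are strictly positive, so the right-hand side is infinite
      and the event is the whole space.\<close>
    then have infinite: "ereal (2 * L) * ereal_sqrt (kl_div P Q / ereal (real T)) * ereal (1 / sqrt \<delta>) = \<infinity>"
      using L T \<delta> by (simp add: ereal_sqrt_def)
    show ?thesis unfolding infinite using \<delta> by (simp add: P.prob_space)
  next
    case MInf
    then show ?thesis using kl by simp
  next
    case (real d)
    \<comment> \<open>The gaps are signed, so Markov is applied to their mean square
      \<open>W\<close>, which dominates the square of their average by Cauchy--Schwarz.\<close>
    define W where "W = (\<lambda>\<omega>. (\<Sum>t=1..T. (N t (hist \<omega> t))\<^sup>2) / real T)"
    have N2_int: "integrable P (\<lambda>\<omega>. (N t (hist \<omega> t))\<^sup>2)" if t: "t \<in> {1..T}" for t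
    proof (rule P.integrable_const_bound[where B="(2 * L)\<^sup>2"])
      show "AE \<omega> in P. norm ((N t (hist \<omega> t))\<^sup>2) \<le> (2 * L)\<^sup>2"
        by (rule AE_I2) (use power_mono[OF N_bnd[OF t hist_space[OF t]] abs_ge_zero, where n=2] in simp)
    qed (use N_meas[OF t] in measurable)
    have kl': "(\<Sum>t=1..T. (\<integral>\<omega>. (N t (hist \<omega> t))\<^sup>2 \<partial>P)) \<le> 2 * L\<^sup>2 * d"
      using kl L unfolding real by (simp add: sum_divide_distrib[symmetric] field_simps)
    have d: "0 \<le> d"
    proof -
      have "0 \<le> (\<Sum>t=1..T. (\<integral>\<omega>. (N t (hist \<omega> t))\<^sup>2 \<partial>P))"
        by (intro sum_nonneg Bochner_Integration.integral_nonneg) simp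
      with kl' have "0 \<le> 2 * L\<^sup>2 * d" by linarith
      then show ?thesis using L by (simp add: zero_le_mult_iff)
    qed
    define y where "y = 2 * L * sqrt (d / real T) * (1 / sqrt \<delta>)"
    have y2: "y\<^sup>2 = 4 * L\<^sup>2 * d / (real T * \<delta>)" and y0: "0 \<le> y"
      using d \<delta> L by (simp_all add: y_def power_mult_distrib power_divide)
    have W_int: "integrable P W"
      unfolding W_def using N2_int by (intro integrable_divide Bochner_Integration.integrable_sum)
    have "1 - \<delta> \<le> P.prob {\<omega> \<in> space P. R \<omega> < y + \<epsilon>}"
    proof (rule tail[of "\<lambda>\<omega>. (\<Sum>t=1..T. N t (hist \<omega> t)) / real T"])
      have "P.prob {\<omega> \<in> space P. y < (\<Sum>t=1..T. N t (hist \<omega> t)) / real T} \<le> P.prob {\<omega> \<in> space P. y\<^sup>2 < W \<omega>}"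
      proof (rule P.finite_measure_mono)
        show "{\<omega> \<in> space P. y < (\<Sum>t=1..T. N t (hist \<omega> t)) / real T} \<subseteq> {\<omega> \<in> space P. y\<^sup>2 < W \<omega>}"
        proof (rule Collect_mono, safe)
          fix \<omega> assume "y < (\<Sum>t=1..T. N t (hist \<omega> t)) / real T"
          then have "y\<^sup>2 < ((\<Sum>t=1..T. N t (hist \<omega> t)) / real T)\<^sup>2"
            using y0 by (intro power_strict_mono) auto
          also have "\<dots> \<le> W \<omega>"
            using sum_squared_le_sum_of_squares[of "\<lambda>t. N t (hist \<omega> t)" "{1..T}"] T
            by (simp add: W_def power_divide field_simps power2_eq_square)
          finally show "y\<^sup>2 < W \<omega>" .
        qed
        show "{\<omega> \<in> space P. y\<^sup>2 < W \<omega>} \<in> P.events" using W_int by measurable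
      qed
      also have "\<dots> \<le> \<delta> / 2"
      proof (rule P.prob_gt_le_of_expectation_le[OF W_int])
        show "0 \<le> W \<omega>" for \<omega> unfolding W_def by (intro divide_nonneg_nonneg sum_nonneg) auto
        have "P.expectation W = (\<Sum>t=1..T. (\<integral>\<omega>. (N t (hist \<omega> t))\<^sup>2 \<partial>P)) / real T"
          unfolding W_def using N2_int by (simp add: Bochner_Integration.integral_sum)
        also have "\<dots> \<le> 2 * L\<^sup>2 * d / real T" using kl' by (intro divide_right_mono) auto
        \<comment> \<open>This identity fixes the factor \<open>2 * L\<close> in \<open>y\<close>:
          squared and multiplied by \<open>\<delta> / 2\<close>, it matches the bound
          \<open>2 * L\<^sup>2 * d / real T\<close>.\<close>
        also have "\<dots> = y\<^sup>2 * (\<delta> / 2)" using \<delta> T by (simp add: y2)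
        finally show "P.expectation W \<le> y\<^sup>2 * (\<delta> / 2)" .
      qed (use \<delta> in auto)
      finally show "P.prob {\<omega> \<in> space P. y < (\<Sum>t=1..T. N t (hist \<omega> t)) / real T} \<le> \<delta> / 2" .
    qed (use N_meas in \<open>auto intro!: borel_measurable_divide borel_measurable_sum\<close>)
    moreover have finite: "ereal (2 * L) * ereal_sqrt (kl_div P Q / ereal (real T)) * ereal (1 / sqrt \<delta>) = ereal y"
      using T by (simp add: real ereal_sqrt_def y_def)
    ultimately show ?thesis
      unfolding finite R_def \<epsilon>_def by simp
  qed
qed

end
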